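(* Any correct tiling of the plane by triangles is non-periodic. Consequently, any correct tiling by square tiles is also non-periodic.
   Context: Crossings. In a tiling whose edges are arrows (each edge has an orientation and a color, red or green), the crossing centered at a vertex is the set of arrows entering or leaving this vertex. The axis of a crossing is a pair of arrows of the same color and same direction passing straight through the center. A crossing of type $C_8$ (allowed in any rotation by a multiple of $45^\circ$) consists of: an axis; two arrows of different colors perpendicular to the axis, both entering the center; and four arrows leaving the center at $45^\circ$ to the axis; moreover, if one goes to the center perpendicular to the axis, the green perpendicular arrow is to the right and the red one to the left. A crossing of type $C_4$ (allowed in any rotation by a multiple of $90^\circ$) consists of an axis and two arrows perpendicular to the axis entering the center from opposite sides. Triangular tiles: isosceles right triangles colored red or green, each side being an arrow with an orientation and a color (red or green); rotations by multiples of $90^\circ$ are allowed. A correct tiling of the plane by triangles is a tiling of the whole plane by such tiles satisfying: (1) tiles are attached side by side and shared sides have matching colors and orientations; (2) any two triangles with a common side have different colors; (3) every crossing is of type $C_4$ or $C_8$; (4) if one goes to the center of a $C_4$ crossing perpendicular to its axis, there is a red triangle on the left and a green triangle on the right. Square tiles: unit squares cut by their diagonals into four isosceles right triangles, each colored red or green, with the sides and half-diagonals being colored oriented arrows and the centre a $C_4$ crossing; rotations by multiples of $90^\circ$ allowed, no flips. A correct tiling by square tiles is a tiling of the whole plane by such tiles with matching shared sides, adjacent triangles of different colors, and a $C_8$ crossing at every vertex. Cutting a correct square tiling along the half-diagonals gives a correct triangle tiling, and every correct triangle tiling arises uniquely this way.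
   Formalization: In the C_8 crossing the right/left colour clause is applied to the arrows leaving at 45° to the axis that flank the path (right green, left red), since the arrows perpendicular to the axis lie ahead and behind; these are only required to have different colours. *)

theory Defs
  imports "HOL-Analysis.Analysis"
begin

text \<open>The plane is \<^typ>\<open>complex\<close>; multiplication by \<open>\<i>\<close> is the counterclockwise rotation by
  \<open>90\<degree>\<close>, multiplication by \<open>cis (pi / 4)\<close> the one by \<open>45\<degree>\<close>.\<close>

datatype color = Red | Green

datatype arrow = Arrow (tail: complex) (head: complex) (acolor: color)

definition shift_arrow :: "complex \<Rightarrow> arrow \<Rightarrow> arrow" where
  "shift_arrow w a = Arrow (tail a + w) (head a + w) (acolor a)"

definition ends :: "arrow \<Rightarrow> complex set" where
  "ends a = {tail a, head a}"

definition quarter_turns :: "complex \<Rightarrow> complex set" where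
  "quarter_turns u = {\<i> ^ k * u | k. k < 4}"

definition eighth_turns :: "complex \<Rightarrow> complex set" where
  "eighth_turns u = {cis (pi / 4) ^ k * u | k. k < 8}"


text \<open>A placed triangular tile with right angle at \<open>apex t\<close>. Its two legs, seen from the apex, are the
  vectors \<open>leg t\<close> and \<open>\<i> * leg t\<close>, so that \<open>leg t\<close> is the leg bounding the triangle clockwise;
  \<open>sides t\<close> consists of the three coloured arrows along its sides.\<close>

datatype triangle = Triangle (apex: complex) (leg: complex) (tcolor: color) (sides: "arrow set")

definition shift_triangle :: "complex \<Rightarrow> triangle \<Rightarrow> triangle" where
  "shift_triangle w t = Triangle (apex t + w) (leg t) (tcolor t) (shift_arrow w ` sides t)"

definition triangle_vertices :: "triangle \<Rightarrow> complex set" where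
  "triangle_vertices t = {apex t, apex t + leg t, apex t + \<i> * leg t}"

text \<open>\<open>u\<close> is the leg of the tiles in their basic position: it fixes their common size and the
  direction of their sides up to rotations by multiples of \<open>90\<degree>\<close>.\<close>

definition triangular_tile :: "complex \<Rightarrow> triangle \<Rightarrow> bool" where
  "triangular_tile u t \<longleftrightarrow> leg t \<in> quarter_turns u \<and>
     (\<exists>a b c. sides t = {a, b, c} \<and>
        ends a = {apex t, apex t + leg t} \<and>
        ends b = {apex t, apex t + \<i> * leg t} \<and>
        ends c = {apex t + leg t, apex t + \<i> * leg t})"


text \<open>\<open>V\<close> assigns to a tile the vertices of the convex polygon it occupies.\<close>

definition side_to_side_tiling :: "('a \<Rightarrow> complex set) \<Rightarrow> 'a set \<Rightarrow> bool" where
  "side_to_side_tiling V T \<longleftrightarrow>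
     (\<Union>t\<in>T. convex hull (V t)) = UNIV \<and>
     (\<forall>s\<in>T. \<forall>t\<in>T. s \<noteq> t \<longrightarrow>
        interior (convex hull (V s)) \<inter> interior (convex hull (V t)) = {} \<and>
        convex hull (V s) \<inter> convex hull (V t) = convex hull (V s \<inter> V t))"

definition shared_sides_match :: "triangle set \<Rightarrow> bool" where
  "shared_sides_match T \<longleftrightarrow>
     (\<forall>s\<in>T. \<forall>t\<in>T. \<forall>a\<in>sides s. \<forall>b\<in>sides t. ends a = ends b \<longrightarrow> a = b)"

definition neighbours_differ :: "triangle set \<Rightarrow> bool" where
  "neighbours_differ T \<longleftrightarrow>
     (\<forall>s\<in>T. \<forall>t\<in>T. s \<noteq> t \<and> (\<exists>a\<in>sides s. \<exists>b\<in>sides t. ends a = ends b) \<longrightarrow> tcolor s \<noteq> tcolor t)"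


definition crossing :: "triangle set \<Rightarrow> complex \<Rightarrow> arrow set" where
  "crossing T x = {a \<in> \<Union> (sides ` T). x \<in> ends a}"

definition enters_from :: "complex \<Rightarrow> complex \<Rightarrow> arrow \<Rightarrow> bool" where
  "enters_from x d a \<longleftrightarrow> head a = x \<and> (\<exists>r>0. tail a = x + of_real r * d)"

definition leaves_towards :: "complex \<Rightarrow> complex \<Rightarrow> arrow \<Rightarrow> bool" where
  "leaves_towards x d a \<longleftrightarrow> tail a = x \<and> (\<exists>r>0. head a = x + of_real r * d)"

text \<open>In \<open>C4 x d A\<close> and \<open>C8 x d A\<close>, the arrows \<open>a\<close> and \<open>b\<close> form the axis, and \<open>d\<close> is its direction.\<close>

definition C4 :: "complex \<Rightarrow> complex \<Rightarrow> arrow set \<Rightarrow> bool" where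
  "C4 x d A \<longleftrightarrow> (\<exists>a b p q. A = {a, b, p, q} \<and>
     enters_from x (- d) a \<and> leaves_towards x d b \<and> acolor a = acolor b \<and>
     enters_from x (\<i> * d) p \<and> enters_from x (- \<i> * d) q)"

text \<open>Whoever walks to \<open>x\<close> perpendicularly to the axis comes from \<open>\<i> * d\<close> or from \<open>- \<i> * d\<close>. In either
  case the path of the walker is flanked by two of the arrows leaving \<open>x\<close> at \<open>45\<degree>\<close> to the axis: the one on
  the right, at \<open>45\<degree>\<close> counterclockwise around \<open>x\<close> from the path, is green (\<open>g\<close>, \<open>g'\<close>), and the one on the
  left is red (\<open>h\<close>, \<open>h'\<close>).\<close>

definition C8 :: "complex \<Rightarrow> complex \<Rightarrow> arrow set \<Rightarrow> bool" where
  "C8 x d A \<longleftrightarrow> (\<exists>a b p q g h g' h'. A = {a, b, p, q, g, h, g', h'} \<and>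
     enters_from x (- d) a \<and> leaves_towards x d b \<and> acolor a = acolor b \<and>
     enters_from x (\<i> * d) p \<and> enters_from x (- \<i> * d) q \<and> acolor p \<noteq> acolor q \<and>
     leaves_towards x (cis (pi / 4) * (\<i> * d)) g \<and> acolor g = Green \<and>
     leaves_towards x (cis (- pi / 4) * (\<i> * d)) h \<and> acolor h = Red \<and>
     leaves_towards x (cis (pi / 4) * (- \<i> * d)) g' \<and> acolor g' = Green \<and>
     leaves_towards x (cis (- pi / 4) * (- \<i> * d)) h' \<and> acolor h' = Red)"

definition on_left :: "arrow \<Rightarrow> triangle \<Rightarrow> bool" where
  "on_left a t \<longleftrightarrow> (\<forall>z\<in>triangle_vertices t. Im (cnj (head a - tail a) * (z - tail a)) \<ge> 0)"

definition on_right :: "arrow \<Rightarrow> triangle \<Rightarrow> bool" where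
  "on_right a t \<longleftrightarrow> (\<forall>z\<in>triangle_vertices t. Im (cnj (head a - tail a) * (z - tail a)) \<le> 0)"

text \<open>The two arrows perpendicular to the axis of a \<open>C4\<close> crossing enter its center, so going to the center
  perpendicularly to the axis is following one of them.\<close>

definition red_left_green_right :: "triangle set \<Rightarrow> complex \<Rightarrow> complex \<Rightarrow> bool" where
  "red_left_green_right T x d \<longleftrightarrow>
     (\<forall>p\<in>crossing T x. enters_from x (\<i> * d) p \<or> enters_from x (- \<i> * d) p \<longrightarrow>
        (\<exists>t\<in>T. p \<in> sides t \<and> on_left p t \<and> tcolor t = Red) \<and>
        (\<exists>t\<in>T. p \<in> sides t \<and> on_right p t \<and> tcolor t = Green))"

definition correct_triangle_tiling :: "complex \<Rightarrow> triangle set \<Rightarrow> bool" where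
  "correct_triangle_tiling u T \<longleftrightarrow>
     (\<forall>t\<in>T. triangular_tile u t) \<and>
     side_to_side_tiling triangle_vertices T \<and>
     shared_sides_match T \<and>
     neighbours_differ T \<and>
     (\<forall>x\<in>\<Union> (triangle_vertices ` T).
        (\<exists>d\<in>quarter_turns u. C4 x d (crossing T x)) \<or> (\<exists>d\<in>eighth_turns u. C8 x d (crossing T x))) \<and>
     (\<forall>x. \<forall>d\<in>quarter_turns u. C4 x d (crossing T x) \<longrightarrow> red_left_green_right T x d)"


text \<open>A placed square tile, given with the four triangles into which it is cut by its diagonals;
  \<open>u\<close> is a half-diagonal.\<close>

datatype square = Square (center: complex) (quarters: "triangle set")

definition shift_square :: "complex \<Rightarrow> square \<Rightarrow> square" where
  "shift_square w s = Square (center s + w) (shift_triangle w ` quarters s)"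

definition square_vertices :: "complex \<Rightarrow> square \<Rightarrow> complex set" where
  "square_vertices u s = (\<lambda>d. center s + d) ` quarter_turns u"

definition square_tile :: "complex \<Rightarrow> square \<Rightarrow> bool" where
  "square_tile u s \<longleftrightarrow>
     (\<forall>t\<in>quarters s. triangular_tile u t \<and> apex t = center s) \<and>
     (\<forall>d\<in>quarter_turns u. \<exists>!t. t \<in> quarters s \<and> leg t = d) \<and>
     shared_sides_match (quarters s) \<and>
     (\<exists>d\<in>quarter_turns u. C4 (center s) d (crossing (quarters s) (center s)) \<and>
        red_left_green_right (quarters s) (center s) d)"

definition correct_square_tiling :: "complex \<Rightarrow> square set \<Rightarrow> bool" where
  "correct_square_tiling u S \<longleftrightarrow>
     (\<forall>s\<in>S. square_tile u s) \<and>
     side_to_side_tiling (square_vertices u) S \<and>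
     shared_sides_match (\<Union> (quarters ` S)) \<and>
     neighbours_differ (\<Union> (quarters ` S)) \<and>
     (\<forall>x\<in>\<Union> (square_vertices u ` S). \<exists>d\<in>eighth_turns u. C8 x d (crossing (\<Union> (quarters ` S)) x))"


text \<open>\<open>shift\<close> is the action of translations on tiles.\<close>

definition periodic :: "(complex \<Rightarrow> 'a \<Rightarrow> 'a) \<Rightarrow> 'a set \<Rightarrow> bool" where
  "periodic shift T \<longleftrightarrow> (\<exists>w. w \<noteq> 0 \<and> shift w ` T = T)"

end

theory Submission
  imports Defs
begin

text \<open>The tiles form a square lattice: the centers of the squares are the \<^const>\<open>C4\<close> crossings and the corners the
  \<^const>\<open>C8\<close> crossings. The colours of the triangles force the axes of the \<^const>\<open>C4\<close> crossings to alternate between the two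
  diagonals like the colours of a checkerboard. Hence the axes join the lattice points of one parity to a
  lattice scaled by \<open>\<surd>2\<close>, and the arrows along it again form crossings of the same two kinds, now centered
  the other way round: the tiling can be composed. On the composed level there are no triangle colours, but the
  colours of the arrows alone force the axes to alternate again, so composition can be iterated. A period maps
  vertices whose axis is diagonal to such vertices, all of which have the same parity; so it lies in the
  sublattice of the composed tiling, and is a period of it. Therefore it lies in lattices of arbitrarily
  large minimal distance, and vanishes.\<close>

text \<open>Reducing the tiling to two Boolean functions on integer points and eight directions is
  what lets composition iterate: the composed structure is an instance of the same locale, although
  no tiles belong to it. The two kinds of crossings are exchanged because every vertex of the parity
  left out has its axis along grid edges; without its four outgoing half-diagonals it looks like a
  \<open>C4\<close> crossing. The obstacle is alternation without triangle colours. It rests on the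
  different colours of the two arrows perpendicular to the axis of a \<open>C8\<close> crossing, a
  property inherited by the centers of composed squares but not granted at those of the original
  ones; hence the first level has its own argument. Periodicity is only ever demanded of the
  orientations, and composition turns a period (p, q) into one with half the value of p^2 + q^2, so
  the growth of the lattices becomes a descent in the natural numbers. In the plane, the crossings
  alone generate a lattice of corners; the side-to-side tiling helps to tell \<open>C4\<close> from
  \<open>C8\<close> vertices and excludes vertices off this lattice.\<close>

section \<open>Grids of arrows\<close>

text \<open>Around a vertex, the directions are numbered counterclockwise modulo \<open>8\<close>: even numbers stand for the
  edges of the grid (\<open>0\<close> is east), odd ones for the half-diagonals. \<open>out\<close> says that the arrow in the given
  direction leaves the vertex, \<open>grn\<close> that it is green; \<open>j\<close> is the direction of the axis of the \<^const>\<open>C8\<close> crossing.\<close>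

definition star :: "int \<Rightarrow> (int \<Rightarrow> bool) \<Rightarrow> (int \<Rightarrow> bool) \<Rightarrow> bool" where
  "star j out grn \<longleftrightarrow>
     out j \<and> \<not> out (j + 4) \<and> grn j = grn (j + 4) \<and>
     \<not> out (j + 2) \<and> \<not> out (j + 6) \<and> grn (j + 2) \<noteq> grn (j + 6) \<and>
     out (j + 1) \<and> out (j + 3) \<and> out (j + 5) \<and> out (j + 7) \<and>
     \<not> grn (j + 1) \<and> grn (j + 3) \<and> \<not> grn (j + 5) \<and> grn (j + 7)"

text \<open>\<open>hub\<close> is the \<open>C4\<close> crossing inside the square with south-west
  corner (x, y), seen from the four corners. An axis enters the center at one end and leaves it at
  the other, so its two corners disagree; the perpendicular arrows enter the center, so they leave
  both of their corners.\<close>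

locale arrow_grid =
  fixes out grn :: "int \<Rightarrow> int \<Rightarrow> int \<Rightarrow> bool"
  assumes out_period: "out x y (k + 8) = out x y k"
    and grn_period: "grn x y (k + 8) = grn x y k"
    and star_ex: "\<exists>j\<in>{0..<8}. star j (out x y) (grn x y)"
    and edge_E: "out x y 0 \<noteq> out (x + 1) y 4" "grn x y 0 = grn (x + 1) y 4"
    and edge_N: "out x y 2 \<noteq> out x (y + 1) 6" "grn x y 2 = grn x (y + 1) 6"
    and hub: "(out x y 1 \<noteq> out (x + 1) (y + 1) 5 \<and> grn x y 1 = grn (x + 1) (y + 1) 5 \<and>
                 out (x + 1) y 3 \<and> out x (y + 1) 7) \<or>
              (out (x + 1) y 3 \<noteq> out x (y + 1) 7 \<and> grn (x + 1) y 3 = grn x (y + 1) 7 \<and>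
                 out x y 1 \<and> out (x + 1) (y + 1) 5)"

text \<open>A \<^const>\<open>C4\<close> crossing does not constrain the colours of the two arrows perpendicular to its axis, but they
  differ in every grid obtained by composition, where the crossing comes from a \<^const>\<open>C8\<close> crossing.\<close>

locale balanced_grid = arrow_grid +
  assumes balance: "if out x y 1 \<noteq> out (x + 1) (y + 1) 5 then grn (x + 1) y 3 \<noteq> grn x (y + 1) 7
                    else grn x y 1 \<noteq> grn (x + 1) (y + 1) 5"

section \<open>Local structure of a grid and its symmetries\<close>

context arrow_grid
begin

lemma reduce_direction:
  "out x y 8 = out x y 0" "out x y 9 = out x y 1" "out x y 10 = out x y 2" "out x y 11 = out x y 3"
  "out x y 12 = out x y 4" "out x y 13 = out x y 5" "out x y 14 = out x y 6"
  "grn x y 8 = grn x y 0" "grn x y 9 = grn x y 1" "grn x y 10 = grn x y 2" "grn x y 11 = grn x y 3"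
  "grn x y 12 = grn x y 4" "grn x y 13 = grn x y 5" "grn x y 14 = grn x y 6"
  using out_period[of x y 0] out_period[of x y 1] out_period[of x y 2] out_period[of x y 3]
    out_period[of x y 4] out_period[of x y 5] out_period[of x y 6]
    grn_period[of x y 0] grn_period[of x y 1] grn_period[of x y 2] grn_period[of x y 3]
    grn_period[of x y 4] grn_period[of x y 5] grn_period[of x y 6]
  by simp_all

lemma star_cases:
  "\<exists>j\<in>{0,1,2,3,4,5,6,7}. star j (out x y) (grn x y)"
proof -
  obtain j where "j \<in> {0..<8}" "star j (out x y) (grn x y)" using star_ex by blast
  moreover have "j \<in> {0..<8} \<Longrightarrow> j \<in> {0,1,2,3,4,5,6,7}" by auto
  ultimately show ?thesis by blast
qed

text \<open>In a \<open>star\<close>, the four directions at odd distance from the axis are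
  outgoing, the others are not all so. Four outgoing edges therefore mean that the axis is a
  half-diagonal.\<close>

definition source :: "int \<Rightarrow> int \<Rightarrow> bool" where
  "source x y \<longleftrightarrow> out x y 0 \<and> out x y 2 \<and> out x y 4 \<and> out x y 6"

lemma source_colours: "source x y \<Longrightarrow> grn x y 0 = grn x y 4 \<and> grn x y 2 = grn x y 6 \<and> grn x y 0 \<noteq> grn x y 2"
  using star_cases[of x y] unfolding star_def source_def by (simp add: reduce_direction) argo

lemma nonsource_diagonals: "\<not> source x y \<Longrightarrow> out x y 1 \<and> out x y 3 \<and> out x y 5 \<and> out x y 7 \<and>
   grn x y 1 = grn x y 5 \<and> grn x y 3 = grn x y 7 \<and> grn x y 1 \<noteq> grn x y 3"
  using star_cases[of x y] unfolding star_def source_def by (simp add: reduce_direction) argo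

lemma nonsource_exit: "\<not> source x y \<Longrightarrow> out x y 0 \<or> out x y 2 \<or> out x y 4 \<or> out x y 6"
  using star_cases[of x y] unfolding star_def source_def by (simp add: reduce_direction) argo

text \<open>With an even axis, the colours of the half-diagonals depend on the line of the axis but
  not on its orientation: red in directions 1 and 5 for a horizontal axis, green there for a
  vertical one. This is how colours will determine axes.\<close>

lemma horizontal: "\<not> source x y \<Longrightarrow> out x y 0 \<or> out x y 4 \<Longrightarrow>
   out x y 0 \<noteq> out x y 4 \<and> \<not> out x y 2 \<and> \<not> out x y 6 \<and> \<not> grn x y 1 \<and> grn x y 3 \<and>
   grn x y 0 = grn x y 4 \<and> grn x y 2 \<noteq> grn x y 6"
  using star_cases[of x y] unfolding star_def source_def by (simp add: reduce_direction) argo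

lemma vertical: "\<not> source x y \<Longrightarrow> out x y 2 \<or> out x y 6 \<Longrightarrow>
   out x y 2 \<noteq> out x y 6 \<and> \<not> out x y 0 \<and> \<not> out x y 4 \<and> grn x y 1 \<and> \<not> grn x y 3 \<and>
   grn x y 2 = grn x y 6 \<and> grn x y 0 \<noteq> grn x y 4"
  using star_cases[of x y] unfolding star_def source_def by (simp add: reduce_direction) argo

lemma source_adjacent: "source x y \<Longrightarrow> \<not> source (x + 1) y" "source x y \<Longrightarrow> \<not> source x (y + 1)"
  using edge_E[of x y] edge_N[of x y] by (auto simp: source_def)

text \<open>Four nonsources would send all four half-diagonals into the center, leaving no arrow for
  the outgoing half of the axis.\<close>

lemma source_in_square: "source x y \<or> source (x + 1) y \<or> source x (y + 1) \<or> source (x + 1) (y + 1)"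
  using hub[of x y] nonsource_diagonals[of x y] nonsource_diagonals[of "x + 1" y]
    nonsource_diagonals[of x "y + 1"] nonsource_diagonals[of "x + 1" "y + 1"] by blast

text \<open>A reflection has to be combined with an exchange of the two colours.\<close>

lemma mirrored: "arrow_grid (\<lambda>x y k. out (- x) y ((12 - k mod 8) mod 8)) (\<lambda>x y k. \<not> grn (- x) y ((12 - k mod 8) mod 8))"
proof (standard, goal_cases)
  case (3 x y)
  obtain j where "j \<in> {0,1,2,3,4,5,6,7}" "star j (out (- x) y) (grn (- x) y)" using star_cases by blast
  \<comment> \<open>The reflection sends direction \<open>k\<close> to 4 - k, and 12 is 4 modulo 8;
    the axis is reflected likewise.\<close>
  then have "star ((12 - j) mod 8) (\<lambda>k. out (- x) y ((12 - k mod 8) mod 8)) (\<lambda>k. \<not> grn (- x) y ((12 - k mod 8) mod 8))"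
    by (elim insertE emptyE) (simp_all add: star_def reduce_direction)
  then show ?case by (intro bexI[of _ "(12 - j) mod 8"]) simp_all
next
  case (8 x y)
  show ?case using hub[of "- x - 1" y] by auto
qed (use edge_E[of "- x - 1" y for x y] edge_N in auto)

lemma rotated: "arrow_grid (\<lambda>x y k. out (- y) x ((k mod 8 + 2) mod 8)) (\<lambda>x y k. grn (- y) x ((k mod 8 + 2) mod 8))"
proof (standard, goal_cases)
  case (3 x y)
  obtain j where "j \<in> {0,1,2,3,4,5,6,7}" "star j (out (- y) x) (grn (- y) x)" using star_cases by blast
  \<comment> \<open>Direction \<open>k\<close> of the new grid is the old \<open>k + 2\<close>, so
    the old axis \<open>j\<close> reappears as j - 2, that is \<open>j + 6\<close>.\<close>
  then have "star ((j + 6) mod 8) (\<lambda>k. out (- y) x ((k mod 8 + 2) mod 8)) (\<lambda>k. grn (- y) x ((k mod 8 + 2) mod 8))"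
    by (elim insertE emptyE) (simp_all add: star_def reduce_direction)
  then show ?case by (intro bexI[of _ "(j + 6) mod 8"]) simp_all
next
  case (8 x y)
  show ?case using hub[of "- y - 1" x] by auto
qed (use edge_E[of "- y - 1" x for x y] edge_N in auto)


definition axis_SWNE :: "int \<Rightarrow> int \<Rightarrow> bool" where
  "axis_SWNE x y \<longleftrightarrow> out x y 1 \<noteq> out (x + 1) (y + 1) 5"

text \<open>The axis leaves the center towards one of its ends, and a vertex entered by a
  half-diagonal must be a source.\<close>

lemma axis_through_source:
  "axis_SWNE x y \<Longrightarrow> source x y \<or> source (x + 1) (y + 1)"
  "\<not> axis_SWNE x y \<Longrightarrow> source (x + 1) y \<or> source x (y + 1)"
  using hub[of x y] nonsource_diagonals[of x y] nonsource_diagonals[of "x + 1" y]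
    nonsource_diagonals[of x "y + 1"] nonsource_diagonals[of "x + 1" "y + 1"]
  unfolding axis_SWNE_def by blast+

lemma axis_SWNE_sources:
  assumes "source x y \<or> source (x + 1) (y + 1)"
  shows "axis_SWNE x y"
proof -
  have "\<not> source (x + 1) y" "\<not> source x (y + 1)"
    using assms source_adjacent[of x y] source_adjacent[of "x + 1" y] source_adjacent[of x "y + 1"]
    by auto
  then show ?thesis using axis_through_source(2) by blast
qed

lemma axis_SENW_sources:
  assumes "source (x + 1) y \<or> source x (y + 1)"
  shows "\<not> axis_SWNE x y"
proof -
  have "\<not> source x y" "\<not> source (x + 1) (y + 1)"
    using assms source_adjacent[of x y] source_adjacent[of "x + 1" y] source_adjacent[of x "y + 1"]
    by auto
  then show ?thesis using axis_through_source(1) by blast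
qed

end

section \<open>Faults and the alternation of axes in balanced grids\<close>

context balanced_grid
begin

lemma mirrored_balanced:
  "balanced_grid (\<lambda>x y k. out (- x) y ((12 - k mod 8) mod 8)) (\<lambda>x y k. \<not> grn (- x) y ((12 - k mod 8) mod 8))"
proof (intro balanced_grid.intro mirrored balanced_grid_axioms.intro, goal_cases)
  case (1 x y)
  show ?case using hub[of "- x - 1" y] balance[of "- x - 1" y] by auto
qed

lemma rotated_balanced:
  "balanced_grid (\<lambda>x y k. out (- y) x ((k mod 8 + 2) mod 8)) (\<lambda>x y k. grn (- y) x ((k mod 8 + 2) mod 8))"
proof (intro balanced_grid.intro rotated balanced_grid_axioms.intro, goal_cases)
  case (1 x y)
  show ?case using hub[of "- y - 1" x] balance[of "- y - 1" x] by auto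
qed

lemma balance_SWNE: "source x y \<or> source (x + 1) (y + 1) \<Longrightarrow> grn (x + 1) y 3 \<noteq> grn x (y + 1) 7"
  using axis_SWNE_sources[of x y] balance[of x y] unfolding axis_SWNE_def by auto

lemma balance_SENW: "source (x + 1) y \<or> source x (y + 1) \<Longrightarrow> grn x y 1 \<noteq> grn (x + 1) (y + 1) 5"
  using axis_SENW_sources[of x y] balance[of x y] unfolding axis_SWNE_def by auto

text \<open>If the axes of two horizontally adjacent squares are parallel, then up to symmetry the two sources on
  them are a knight's move apart as in a fault. Faults propagate upwards with alternating mirror
  images. In the column to the left of such an infinite fault line, every other vertex on the rows of the
  incoming horizontal arrows is a source, and the colours on this column and on these rows then have
  incompatible periods.\<close>

definition fault :: "int \<Rightarrow> int \<Rightarrow> bool" where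
  "fault x y \<longleftrightarrow> source (x - 1) y \<and> source (x + 1) (y + 1) \<and> out x y 2"

lemma fault_local:
  assumes "fault x y"
  shows "\<not> source x y" "\<not> source x (y + 1)" "\<not> source (x - 1) (y + 1)" "\<not> source (x + 1) y"
    "out (x + 1) y 4" "out (x - 1) (y + 1) 0" "out x (y + 1) 2" "source (x - 1) (y + 2)"
proof -
  have L: "source (x - 1) y" and R: "source (x + 1) (y + 1)" and N: "out x y 2"
    using assms by (auto simp: fault_def)
  show 1: "\<not> source x y" using source_adjacent[of "x - 1" y] L by simp
  show 2: "\<not> source x (y + 1)" using source_adjacent(1)[of x "y + 1"] R by blast
  show 3: "\<not> source (x - 1) (y + 1)" using source_adjacent[of "x - 1" y] L by simp
  show 4: "\<not> source (x + 1) y" using source_adjacent[of "x + 1" y] R by blast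
  note V = vertical[OF 1]
  show 5: "out (x + 1) y 4" using V N edge_E[of x y] by blast
  \<comment> \<open>The left square has a source at its south-west corner, so its perpendicular
    half-diagonals start at (x, y) and (x - 1, y + 1). The first is red because (x, y) is vertical;
    balance makes the second green, hence (x - 1, y + 1) horizontal. The square on the right is
    treated in the same way below.\<close>
  have "grn x y 3 \<noteq> grn (x - 1) (y + 1) 7" using balance_SWNE[of "x - 1" y] L by simp
  then have "grn (x - 1) (y + 1) 3" using V N nonsource_diagonals[OF 3] by blast
  then have h: "out (x - 1) (y + 1) 0 \<or> out (x - 1) (y + 1) 4"
    using nonsource_exit[OF 3] vertical[OF 3] by blast
  have "grn (x + 1) y 3" using horizontal[OF 4] 5 by blast
  then have "\<not> grn x (y + 1) 7" using balance_SWNE[of x y] R by blast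
  then have "\<not> grn x (y + 1) 3" using nonsource_diagonals[OF 2] by blast
  then have "out x (y + 1) 2 \<or> out x (y + 1) 6"
    using nonsource_exit[OF 2] horizontal[OF 2] by blast
  moreover have "\<not> out x (y + 1) 6" using edge_N[of x y] N by blast
  ultimately show 7: "out x (y + 1) 2" by blast
  then have "\<not> out x (y + 1) 4" using vertical[OF 2] by blast
  then show 6: "out (x - 1) (y + 1) 0" using edge_E[of "x - 1" "y + 1"] by auto
  have 8: "\<not> source x (y + 2)" using edge_N[of x "y + 1"] 7 by (auto simp: source_def add.assoc)
  show "source (x - 1) (y + 2)" using source_in_square[of "x - 1" "y + 1"] 2 3 8 by (simp add: add.assoc)
qed

text \<open>The upward arrow at (x, y + 1) and the source (x - 1, y + 2) found in
  \<open>fault_local\<close>, together with the old source (x + 1, y + 1), form the mirror image of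
  a fault one row higher.\<close>

lemma fault_mirror:
  assumes "fault x y"
  shows "balanced_grid.fault (\<lambda>x y k. out (- x) y ((12 - k mod 8) mod 8)) (- x) (y + 1)"
  using fault_local[OF assms] assms
  unfolding balanced_grid.fault_def[OF mirrored_balanced] arrow_grid.source_def[OF mirrored]
  by (simp add: fault_def source_def add.assoc add.commute)

lemma fault_up:
  assumes "fault x y"
  shows "out (x + 1) (y + 2) 4" "out x (y + 2) 2" "source (x + 1) (y + 3)" "fault x (y + 2)"
proof -
  interpret M: balanced_grid "\<lambda>x y k. out (- x) y ((12 - k mod 8) mod 8)"
    "\<lambda>x y k. \<not> grn (- x) y ((12 - k mod 8) mod 8)"
    by (rule mirrored_balanced)
  note M = M.fault_local[OF fault_mirror[OF assms]]
  show 1: "out (x + 1) (y + 2) 4" and 2: "out x (y + 2) 2" and 3: "source (x + 1) (y + 3)"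
    using M(6,7,8) unfolding M.source_def source_def by (simp_all add: algebra_simps)
  show "fault x (y + 2)"
    using 2 3 fault_local(8)[OF assms] by (simp add: fault_def add.assoc)
qed

text \<open>Crossing the fault line at a vertical vertex changes the colour of a row. To the right
  of the line, the horizontal vertex (x + 1, y + 2) has vertical arrows of different colours; the
  sources above and below it pass this difference on to their rows. So the row colours alternate,
  and agree again four rows further up.\<close>

lemma fault_colours:
  assumes "fault x y"
  shows "grn (x - 1) (y + 1) 0 \<noteq> grn (x - 1) (y + 3) 0"
proof -
  have col: "grn (x - 1) (y + 1) 0 \<noteq> grn (x + 1) (y + 1) 4" if "fault x y" for y
    using vertical[OF fault_local(2)[OF that]] fault_local(7)[OF that]
      edge_E(2)[of "x - 1" "y + 1"] edge_E(2)[of x "y + 1"] by auto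
  have "\<not> source (x + 1) (y + 2)" "out (x + 1) (y + 2) 4"
    using fault_up[OF assms] fault_local(4)[of x "y + 2"] by auto
  then have "grn (x + 1) (y + 2) 2 \<noteq> grn (x + 1) (y + 2) 6"
    using horizontal by blast
  then have "grn (x + 1) (y + 3) 6 \<noteq> grn (x + 1) (y + 1) 2"
    using edge_N(2)[of "x + 1" "y + 2"] edge_N(2)[of "x + 1" "y + 1"] by (simp add: add.assoc)
  then have "grn (x + 1) (y + 1) 4 \<noteq> grn (x + 1) (y + 3) 4"
    using source_colours[of "x + 1" "y + 1"] source_colours[of "x + 1" "y + 3"] fault_up(3)[OF assms] assms
    unfolding fault_def by blast
  then show ?thesis
    using col[OF assms] col[OF fault_up(4)[OF assms]] by (auto simp: add.assoc)
qed

text \<open>Next to the sources in column x - 1, balance fixes the half-diagonal colours in column x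
  - 2 and makes (x - 2, y) and (x - 2, y + 2) vertical. The row in between only forces an arrow to
  the east: that vertex is a source or horizontal.\<close>

lemma fault_left_column:
  assumes "fault x y"
  shows "\<not> source (x - 2) y" "out (x - 2) y 2 \<noteq> out (x - 2) y 6" "grn (x - 2) y 2 = grn (x - 2) y 6"
    "\<not> source (x - 2) (y + 2)" "out (x - 2) (y + 1) 0"
    "out (x - 2) (y + 2) 2 \<noteq> out (x - 2) (y + 2) 6" "grn (x - 2) (y + 2) 2 = grn (x - 2) (y + 2) 6"
proof -
  have L: "source (x - 1) y" and L2: "source (x - 1) (y + 2)"
    using assms fault_local(8) by (auto simp: fault_def)
  note h = horizontal[OF fault_local(3)[OF assms]] fault_local(6)[OF assms]
  have d: "\<not> grn (x - 1) (y + 1) 5"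
    using h nonsource_diagonals[OF fault_local(3)[OF assms]] by blast
  show 1: "\<not> source (x - 2) y" using source_adjacent(1)[of "x - 2" y] L by auto
  have "grn (x - 2) y 1"
    using balance_SENW[of "x - 2" y] L d by simp
  then have "out (x - 2) y 2 \<or> out (x - 2) y 6" using nonsource_exit[OF 1] horizontal[OF 1] by blast
  then show "out (x - 2) y 2 \<noteq> out (x - 2) y 6" "grn (x - 2) y 2 = grn (x - 2) y 6"
    using vertical[OF 1] by blast+
  show 2: "\<not> source (x - 2) (y + 2)" using source_adjacent(1)[of "x - 2" "y + 2"] L2 by auto
  have "\<not> grn (x - 2) (y + 2) 7"
    using balance_SWNE[of "x - 2" "y + 1"] L2 h by (simp add: add.assoc)
  then have "\<not> grn (x - 2) (y + 2) 3" using nonsource_diagonals[OF 2] by blast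
  then have "out (x - 2) (y + 2) 2 \<or> out (x - 2) (y + 2) 6"
    using nonsource_exit[OF 2] horizontal[OF 2] by blast
  then show "out (x - 2) (y + 2) 2 \<noteq> out (x - 2) (y + 2) 6" "grn (x - 2) (y + 2) 2 = grn (x - 2) (y + 2) 6"
    using vertical[OF 2] by blast+
  show "out (x - 2) (y + 1) 0"
    using h edge_E(1)[of "x - 2" "y + 1"] by simp
qed

text \<open>Following the column upwards, the next source is at y + 5. Of the vertices in between,
  the vertical ones transmit the colour and only the horizontal one at y + 3 changes it, so the two
  sources have rows of different colours. By \<open>fault_colours\<close>, applied twice, these rows
  have equal colours.\<close>

lemma no_fault_source:
  assumes "fault x y" "source (x - 2) (y + 1)"
  shows False
proof -
  have f2: "fault x (y + 2)" and f4: "fault x (y + 4)"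
    using fault_up(4)[OF assms(1)] fault_up(4)[of x "y + 2"] by (simp_all add: add.assoc)
  note c0 = fault_left_column[OF assms(1)] and c2 = fault_left_column[OF f2, simplified add.assoc, simplified]
    and c4 = fault_left_column[OF f4, simplified add.assoc, simplified]
  note e1 = edge_N[of "x - 2" "y + 1", simplified add.assoc, simplified]
    and e2 = edge_N[of "x - 2" "y + 2", simplified add.assoc, simplified]
    and e3 = edge_N[of "x - 2" "y + 3", simplified add.assoc, simplified]
    and e4 = edge_N[of "x - 2" "y + 4", simplified add.assoc, simplified]
  have o2: "out (x - 2) (y + 2) 2" using assms(2) e1 c0 by (simp add: source_def)
  have n3: "\<not> source (x - 2) (y + 3)" using o2 e2 by (simp add: source_def)
  note h3 = horizontal[OF n3]
  have "\<not> out (x - 2) (y + 3) 2" using h3 c2(5) by blast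
  then have "out (x - 2) (y + 4) 6" using e3 by blast
  then have o5: "out (x - 2) (y + 5) 6" using c4(2) e4 by blast
  have s5: "source (x - 2) (y + 5)" using horizontal[of "x - 2" "y + 5"] o5 c4(5) by blast
  have "grn (x - 2) (y + 1) 2 \<noteq> grn (x - 2) (y + 5) 6"
    using h3 c2(5) e1(2) e2(2) e3(2) e4(2) c0(7) c4(3) by blast
  then have "grn (x - 2) (y + 1) 0 \<noteq> grn (x - 2) (y + 5) 0"
    using source_colours[OF s5] source_colours[OF assms(2)] by blast
  moreover have "grn (x - 2) (y + 1) 0 = grn (x - 1) (y + 1) 0" if "fault x y" for y
    using horizontal[OF fault_local(3)[OF that]] fault_local(6)[OF that] edge_E(2)[of "x - 2" "y + 1"] by simp
  from this[OF assms(1)] this[OF f4]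
  have "grn (x - 2) (y + 1) 0 = grn (x - 1) (y + 1) 0" "grn (x - 2) (y + 5) 0 = grn (x - 1) (y + 5) 0"
    by (simp_all add: add.assoc)
  ultimately show False
    using fault_colours[OF assms(1)] fault_colours[OF f2] by (simp add: add.assoc)
qed

text \<open>If (x - 2, y + 1) is not a source, it is horizontal and absorbs the vertical arrow above
  it; the vertical vertex at y + 2 then forces a source at y + 3, which is the excluded position for
  the fault two rows higher.\<close>

lemma no_fault: "\<not> fault x y"
proof
  assume f: "fault x y"
  have f2: "fault x (y + 2)"
    using fault_up(4)[OF f] by (simp add: add.assoc)
  note c0 = fault_left_column[OF f] and c2 = fault_left_column[OF f2, simplified add.assoc, simplified]
  have n: "\<not> source (x - 2) (y + 1)" using no_fault_source[OF f] by blast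
  have "\<not> out (x - 2) (y + 1) 2" using horizontal[OF n] c0(5) by blast
  then have "out (x - 2) (y + 2) 6" using edge_N[of "x - 2" "y + 1"] by (simp add: add.assoc)
  then have "out (x - 2) (y + 3) 6" using c0(6) edge_N[of "x - 2" "y + 2"] by (simp add: add.assoc)
  then have "source (x - 2) (y + 3)" using horizontal[of "x - 2" "y + 3"] c2(5) by blast
  then show False using no_fault_source[OF f2] by (simp add: add.assoc)
qed

text \<open>The vertical edge from (x + 1, y) to (x + 1, y + 1) points up, giving a fault, or down,
  giving a fault after a half-turn.\<close>

lemma no_knight_move: "\<not> (source x y \<and> source (x + 2) (y + 1))"
proof
  assume s: "source x y \<and> source (x + 2) (y + 1)"
  interpret R: balanced_grid "\<lambda>x y k. out (- y) x ((k mod 8 + 2) mod 8)"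
    "\<lambda>x y k. grn (- y) x ((k mod 8 + 2) mod 8)"
    by (rule rotated_balanced)
  interpret RR: balanced_grid "\<lambda>x y k. out (- x) (- y) (((k mod 8 + 2) mod 8 mod 8 + 2) mod 8)"
    "\<lambda>x y k. grn (- x) (- y) (((k mod 8 + 2) mod 8 mod 8 + 2) mod 8)"
    by (rule R.rotated_balanced)
  have "\<not> out (x + 1) y 2" using no_fault[of "x + 1" y] s by (simp add: fault_def add.assoc)
  then have "out (x + 1) (y + 1) 6" using edge_N[of "x + 1" y] by blast
  then have "RR.fault (- x - 1) (- y - 1)"
    using s unfolding RR.fault_def RR.source_def source_def by (simp add: algebra_simps)
  then show False using RR.no_fault by blast
qed

text \<open>Each of two parallel axes has a source at an end. As sources are never adjacent, only
  the two ends a knight's move apart remain possible.\<close>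

lemma axis_alternates_E: "axis_SWNE x y \<noteq> axis_SWNE (x + 1) y"
proof -
  interpret M: balanced_grid "\<lambda>x y k. out (- x) y ((12 - k mod 8) mod 8)"
    "\<lambda>x y k. \<not> grn (- x) y ((12 - k mod 8) mod 8)"
    by (rule mirrored_balanced)
  have k: "\<not> (source x y \<and> source (x + 2) (y + 1))" by (rule no_knight_move)
  have k': "\<not> (source (x + 2) y \<and> source x (y + 1))"
    using M.no_knight_move[of "- x - 2" y] unfolding M.source_def source_def by (simp add: algebra_simps)
  show ?thesis
    using k k' axis_through_source[of x y] axis_through_source[of "x + 1" y]
      source_adjacent[of x y] source_adjacent[of "x + 1" y] source_adjacent[of "x + 1" "y + 1"]
      source_adjacent[of x "y + 1"]
    by (simp add: add.assoc) argo
qed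

lemma axis_alternates_N: "axis_SWNE x y \<noteq> axis_SWNE x (y + 1)"
proof -
  interpret R: balanced_grid "\<lambda>x y k. out (- y) x ((k mod 8 + 2) mod 8)"
    "\<lambda>x y k. grn (- y) x ((k mod 8 + 2) mod 8)"
    by (rule rotated_balanced)
  \<comment> \<open>The rotated square with south-west corner (y, - x - 1) is the original one at
    (x, y); a quarter turn exchanges its diagonals.\<close>
  have "R.axis_SWNE y (- x - 1) \<longleftrightarrow> \<not> axis_SWNE x y" for x y
    using hub[of x y] unfolding R.axis_SWNE_def axis_SWNE_def by (simp add: add.commute) argo
  then show ?thesis using R.axis_alternates_E[of y "- x - 1"] by auto
qed

end

section \<open>Checkered grids and their composition\<close>

lemma checkered_if_alternating:
  fixes P :: "int \<Rightarrow> int \<Rightarrow> bool"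
  assumes E: "\<And>x y. P x y \<noteq> P (x + 1) y" and N: "\<And>x y. P x y \<noteq> P x (y + 1)"
  shows "\<exists>c. \<forall>x y. P x y \<longleftrightarrow> even (x + y + c)"
proof -
  define Q where "Q x y \<longleftrightarrow> (P x y \<longleftrightarrow> even (x + y))" for x y
  have e: "Q (x + 1) y = Q x y" for x y unfolding Q_def using E[of x y] by auto
  have n: "Q x (y + 1) = Q x y" for x y unfolding Q_def using N[of x y] by auto
  have "Q x y = Q 0 y" for x y
    by (induction x rule: int_induct[where k = 0]) (use e e[of "x - 1" for x] in auto)
  moreover have "Q 0 y = Q 0 0" for y
    by (induction y rule: int_induct[where k = 0]) (use n n[of _ "y - 1" for y] in auto)
  ultimately have "Q x y = Q 0 0" for x y by blast
  then have "P x y \<longleftrightarrow> even (x + y + (if Q 0 0 then 0 else 1))" for x y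
    unfolding Q_def by (cases "Q 0 0") (auto simp: Q_def)
  then show ?thesis by blast
qed

text \<open>The meeting point of the two sources of alternation: triangle colours on the first
  level, \<open>balanced_grid\<close> on the composed ones.\<close>

locale checkered_grid = arrow_grid +
  fixes c :: int
  assumes checkered: "axis_SWNE x y \<longleftrightarrow> even (x + y + c)"
begin

text \<open>A half-diagonal entering a vertex leaves a center, so it lies on an axis; each of the
  four surrounding squares then gives the same parity.\<close>

lemma incoming_diagonal:
  assumes "k \<in> {1,3,5,7}" "\<not> out x y k"
  shows "even (x + y + c)"
proof -
  have "\<not> out x y 1 \<or> \<not> out x y 3 \<or> \<not> out x y 5 \<or> \<not> out x y 7"
    using assms by auto
  then show ?thesis
    using hub[of x y] hub[of "x - 1" y] hub[of x "y - 1"] hub[of "x - 1" "y - 1"]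
      checkered[of x y] checkered[of "x - 1" y] checkered[of x "y - 1"] checkered[of "x - 1" "y - 1"]
    unfolding axis_SWNE_def by (simp add: algebra_simps) argo
qed

lemma source_even: "source x y \<Longrightarrow> even (x + y + c)"
proof -
  assume "source x y"
  then have "\<exists>k\<in>{1,3,5,7}. \<not> out x y k"
    using star_cases[of x y] unfolding star_def source_def by (simp add: reduce_direction) argo
  then show ?thesis using incoming_diagonal by blast
qed

text \<open>An odd vertex is not a source, so its axis is horizontal or vertical. Read from its four
  neighbours, its edges form a \<open>C4\<close> crossing, and the \<open>C8\<close> rule supplies
  different colours for the perpendicular pair.\<close>

lemma odd_vertex_hub:
  assumes "odd (x + y + c)"
  shows "(out x (y - 1) 2 \<noteq> out x (y + 1) 6 \<and> grn x (y - 1) 2 = grn x (y + 1) 6 \<and>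
            out (x + 1) y 4 \<and> out (x - 1) y 0 \<and> grn (x + 1) y 4 \<noteq> grn (x - 1) y 0) \<or>
         (out (x + 1) y 4 \<noteq> out (x - 1) y 0 \<and> grn (x + 1) y 4 = grn (x - 1) y 0 \<and>
            out x (y - 1) 2 \<and> out x (y + 1) 6 \<and> grn x (y - 1) 2 \<noteq> grn x (y + 1) 6)"
proof -
  have n: "\<not> source x y" using source_even assms by blast
  have e: "out x (y - 1) 2 = (\<not> out x y 6)" "grn x (y - 1) 2 = grn x y 6"
    "out x (y + 1) 6 = (\<not> out x y 2)" "grn x (y + 1) 6 = grn x y 2"
    "out (x + 1) y 4 = (\<not> out x y 0)" "grn (x + 1) y 4 = grn x y 0"
    "out (x - 1) y 0 = (\<not> out x y 4)" "grn (x - 1) y 0 = grn x y 4"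
    using edge_N[of x "y - 1"] edge_N[of x y] edge_E[of x y] edge_E[of "x - 1" y] by auto
  show ?thesis unfolding e using nonsource_exit[OF n] horizontal[OF n] vertical[OF n] by blast
qed

text \<open>The even vertices, with the axes of the squares as edges, form a grid scaled by \<open>\<surd>2\<close> and turned by \<open>45\<degree>\<close>;
  its squares are centered at the odd vertices, none of which is a source.\<close>

lemma composed:
  "balanced_grid (\<lambda>x y k. out (x - y + c) (x + y) ((k mod 8 + 1) mod 8))
     (\<lambda>x y k. grn (x - y + c) (x + y) ((k mod 8 + 1) mod 8))"
proof (standard, goal_cases)
  case (3 x y)
  \<comment> \<open>The offset makes \<open>?X + ?Y + c\<close> even, so the image consists of even
    vertices. Direction \<open>k\<close> becomes the old \<open>k + 1\<close>, which turns the axis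
    \<open>j\<close> into j - 1, that is \<open>j + 7\<close>.\<close>
  let ?X = "x - y + c" and ?Y = "x + y"
  obtain j where "j \<in> {0,1,2,3,4,5,6,7}" "star j (out ?X ?Y) (grn ?X ?Y)" using star_cases by blast
  then have "star ((j + 7) mod 8) (\<lambda>k. out ?X ?Y ((k mod 8 + 1) mod 8)) (\<lambda>k. grn ?X ?Y ((k mod 8 + 1) mod 8))"
    by (elim insertE emptyE) (simp_all add: star_def reduce_direction)
  then show ?case by (intro bexI[of _ "(j + 7) mod 8"]) simp_all
next
  case (4 x y)
  show ?case using checkered[of "x - y + c" "x + y"] by (simp add: axis_SWNE_def algebra_simps)
next
  case (5 x y)
  show ?case using checkered[of "x - y + c" "x + y"] hub[of "x - y + c" "x + y"]
    unfolding axis_SWNE_def by (simp add: algebra_simps; argo)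
next
  case (6 x y)
  \<comment> \<open>The edge to the north is the old direction 3, across the square to the west;
    this square is odd, so its axis runs that way.\<close>
  show ?case using checkered[of "x - y + c - 1" "x + y"] hub[of "x - y + c - 1" "x + y"]
    unfolding axis_SWNE_def by (simp add: algebra_simps; argo)
next
  case (7 x y)
  show ?case using checkered[of "x - y + c - 1" "x + y"] hub[of "x - y + c - 1" "x + y"]
    unfolding axis_SWNE_def by (simp add: algebra_simps; argo)
next
  case (8 x y)
  \<comment> \<open>The center of the composed square is the odd vertex directly north of its
    corner.\<close>
  show ?case using odd_vertex_hub[of "x - y + c" "x + y + 1"] by (simp add: algebra_simps) blast
next
  case (9 x y)
  show ?case using odd_vertex_hub[of "x - y + c" "x + y + 1"] by (simp add: algebra_simps) blast
qed simp_all

lemma period_even: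
  assumes "\<And>x y k. out (x + p) (y + q) k = out x y k"
  shows "even (p + q)"
proof -
  obtain x y k where k: "k \<in> {1,3,5,7}" "\<not> out x y k"
    using hub[of 0 0] by auto
  then have "\<not> out (x + p) (y + q) k" using assms by blast
  from incoming_diagonal[OF k] incoming_diagonal[OF k(1) this] show ?thesis by auto
qed

end

section \<open>Descent on the period\<close>

lemma (in balanced_grid) checkered_grid_ex: "\<exists>c. checkered_grid out grn c"
  using checkered_if_alternating[of axis_SWNE, OF axis_alternates_E axis_alternates_N] arrow_grid_axioms
  by (auto simp: checkered_grid_def checkered_grid_axioms_def)

lemma (in checkered_grid) composed_period:
  assumes "\<And>x y k. out (x + p) (y + q) k = out x y k"
  obtains p' q' where "p = p' - q'" "q = p' + q'"
    "\<And>x y k. out ((x + p') - (y + q') + c) ((x + p') + (y + q')) k = out (x - y + c) (x + y) k"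
proof -
  have "even (p + q)" using period_even assms by blast
  then obtain p' where p': "p + q = 2 * p'" by blast
  define q' where "q' = q - p'"
  have "p = p' - q'" "q = p' + q'" using p' by (auto simp: q'_def)
  moreover have "out ((x + p') - (y + q') + c) ((x + p') + (y + q')) k = out (x - y + c) (x + y) k" for x y k
    using assms[of "x - y + c" "x + y" k] calculation by (simp add: algebra_simps)
  ultimately show thesis using that by blast
qed

text \<open>From p = p' - q' and q = p' + q' follows p^2 + q^2 = 2 (p'^2 + q'^2), so the measure
  drops strictly unless the period vanishes. Orientations suffice, since they alone reveal the
  parity of a vertex.\<close>

lemma balanced_grid_aperiodic:
  assumes "balanced_grid out grn" "\<And>x y k. out (x + p) (y + q) k = out x y k"
  shows "p = 0 \<and> q = 0"
  using assms
proof (induction "nat (p * p + q * q)" arbitrary: p q out grn rule: less_induct)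
  case less
  interpret balanced_grid out grn by (rule less.prems)
  obtain c where "checkered_grid out grn c" using checkered_grid_ex by blast
  then interpret checkered_grid out grn c .
  obtain p' q' where pq: "p = p' - q'" "q = p' + q'"
    and per: "\<And>x y k. out ((x + p') - (y + q') + c) ((x + p') + (y + q')) k = out (x - y + c) (x + y) k"
    using composed_period[OF less.prems(2)] by metis
  have sq: "p * p + q * q = 2 * (p' * p' + q' * q')" unfolding pq by (simp add: algebra_simps)
  show ?case
  proof (cases "p' * p' + q' * q' = 0")
    case True
    then have "p' = 0" "q' = 0" by (simp_all add: sum_squares_eq_zero_iff)
    then show ?thesis using pq by simp
  next
    case False
    then have "p' * p' + q' * q' > 0" by (metis not_sum_squares_lt_zero linorder_neqE)
    then have "nat (p' * p' + q' * q') < nat (p * p + q * q)" unfolding sq by simp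
    from less.hyps[OF this composed] per show ?thesis by (simp add: pq)
  qed
qed

lemma (in checkered_grid) aperiodic:
  assumes "\<And>x y k. out (x + p) (y + q) k = out x y k"
  shows "p = 0 \<and> q = 0"
proof -
  obtain p' q' where pq: "p = p' - q'" "q = p' + q'"
    and per: "\<And>x y k. out ((x + p') - (y + q') + c) ((x + p') + (y + q')) k = out (x - y + c) (x + y) k"
    using composed_period[OF assms] by metis
  from balanced_grid_aperiodic[OF composed, of p' q'] per show ?thesis by (simp add: pq)
qed

section \<open>Crossings in the plane\<close>

text \<open>The steps from a square corner along the eight directions of the grid: the half-diagonal in direction \<open>1\<close>
  is \<open>u\<close>, so the grid edge in direction \<open>0\<close> is \<open>(1 - \<i>) * u\<close>.\<close>

definition dir :: "complex \<Rightarrow> int \<Rightarrow> complex" where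
  "dir u k = u * ((if odd k then 1 else 1 - \<i>) * \<i> ^ nat (k mod 8 div 2))"

lemma dir_values:
  "dir u 0 = u * (1 - \<i>)" "dir u 1 = u" "dir u 2 = u * (1 + \<i>)" "dir u 3 = u * \<i>"
  "dir u 4 = u * (\<i> - 1)" "dir u 5 = - u" "dir u 6 = u * (- 1 - \<i>)" "dir u 7 = - u * \<i>"
  by (simp_all add: dir_def algebra_simps eval_nat_numeral)

lemma dir_mod: "dir u k = dir u (k mod 8)"
  by (simp add: dir_def dvd_mod_iff)

lemma dir_period: "dir u (k + 8) = dir u k"
  by (simp add: dir_def)

lemma mod_8_cases: "(k::int) mod 8 \<in> {0,1,2,3,4,5,6,7}"
proof -
  have "0 \<le> k mod 8" "k mod 8 < 8" by simp_all
  then show ?thesis unfolding insert_iff empty_iff by linarith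
qed

lemma dir_rotate:
  shows dir_add_2: "dir u (k + 2) = \<i> * dir u k"
    and dir_add_4: "dir u (k + 4) = - dir u k"
    and dir_add_6: "dir u (k + 6) = - \<i> * dir u k"
proof -
  have 1: "dir u (k + 2) = dir u ((k mod 8 + 2) mod 8)" "dir u (k + 4) = dir u ((k mod 8 + 4) mod 8)"
    "dir u (k + 6) = dir u ((k mod 8 + 6) mod 8)"  for k
    by (subst dir_mod, simp add: mod_simps)+
  show "dir u (k + 2) = \<i> * dir u k" "dir u (k + 4) = - dir u k" "dir u (k + 6) = - \<i> * dir u k"
    unfolding 1 dir_mod[of u k] using mod_8_cases[of k]
    by (elim insertE emptyE; simp add: dir_values algebra_simps)+
qed

lemma dir_nonzero: "u \<noteq> 0 \<Longrightarrow> dir u k \<noteq> 0"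
proof -
  assume "u \<noteq> 0"
  moreover have "1 - \<i> \<noteq> 0" by (simp add: complex_eq_iff)
  ultimately show ?thesis by (simp add: dir_def)
qed

lemma dir_ray_unique:
  assumes "u \<noteq> 0" "0 < r" "of_real r * dir u k = dir u m"
  shows "k mod 8 = m mod 8"
proof -
  have u: "dir u k = u * dir 1 k" for k by (simp add: dir_def)
  have "of_real r * dir 1 (k mod 8) = dir 1 (m mod 8)"
    using assms unfolding u[of k] u[of m] dir_mod[of 1, symmetric] by (simp add: mult.left_commute)
  then show ?thesis using mod_8_cases[of k] mod_8_cases[of m] assms(2)
    by (elim insertE emptyE; simp add: dir_values complex_eq_iff)
qed

lemma dir_inject: "u \<noteq> 0 \<Longrightarrow> dir u k = dir u m \<longleftrightarrow> k mod 8 = m mod 8"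
  using dir_ray_unique[of u 1 k m] dir_mod[of u k] dir_mod[of u m] by auto

text \<open>Grid edges are sqrt 2 times as long as half-diagonals, so a rotation by 45 degrees maps
  neighbouring steps to each other only up to a positive factor.\<close>

lemma cis_rotate_dir:
  shows "\<exists>r>0. cis (pi / 4) * dir u k = of_real r * dir u (k + 1)"
    and "\<exists>r>0. cis (- pi / 4) * dir u k = of_real r * dir u (k + 7)"
proof -
  define r :: real where "r = (if odd (k mod 8) then sqrt 2 / 2 else sqrt 2)"
  have u: "dir u k = u * dir 1 k" for k by (simp add: dir_def)
  have 1: "dir 1 (k + 1) = dir 1 ((k mod 8 + 1) mod 8)" "dir 1 (k + 7) = dir 1 ((k mod 8 + 7) mod 8)"
    by (subst dir_mod, simp add: mod_simps)+
  have "cis (pi / 4) * dir 1 k = of_real r * dir 1 (k + 1)"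
    unfolding 1 dir_mod[of 1 k] r_def using mod_8_cases[of k]
    by (elim insertE emptyE; simp add: dir_values complex_eq_iff cos_45 sin_45)
  moreover have "cis (- pi / 4) * dir 1 k = of_real r * dir 1 (k + 7)"
    unfolding 1 dir_mod[of 1 k] r_def using mod_8_cases[of k]
    by (elim insertE emptyE; simp add: dir_values complex_eq_iff cos_45 sin_45)
  moreover have "r > 0" by (simp add: r_def)
  ultimately show "\<exists>r>0. cis (pi / 4) * dir u k = of_real r * dir u (k + 1)"
    "\<exists>r>0. cis (- pi / 4) * dir u k = of_real r * dir u (k + 7)"
    unfolding u[of k] u[of "k + 1"] u[of "k + 7"]
    by (auto intro!: exI[of _ r] simp: mult.left_commute)
qed

lemma quarter_turns_dir: "quarter_turns u = dir u ` {1,3,5,7}"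
proof -
  have "{k. k < (4::nat)} = {0,1,2,3}" by auto
  then have "quarter_turns u = (\<lambda>k. \<i> ^ k * u) ` {0,1,2,3}" unfolding quarter_turns_def by blast
  then show ?thesis by (auto simp add: dir_values eval_nat_numeral mult.commute)
qed

lemma eighth_turns_dir:
  assumes "d \<in> eighth_turns u"
  shows "\<exists>j\<in>{0..<8}. \<exists>r>0. d = of_real r * dir u j"
proof -
  obtain n where n: "d = cis (pi / 4) ^ n * u" using assms by (auto simp: eighth_turns_def)
  have "\<exists>r>0. cis (pi / 4) ^ n * u = of_real r * dir u (1 + int n)"
  proof (induction n)
    case 0
    show ?case by (intro exI[of _ 1]) (simp add: dir_values)
  next
    case (Suc n)
    then obtain r where r: "r > 0" "cis (pi / 4) ^ n * u = of_real r * dir u (1 + int n)" by blast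
    obtain r' where r': "r' > 0" "cis (pi / 4) * dir u (1 + int n) = of_real r' * dir u (1 + int n + 1)"
      using cis_rotate_dir(1) by blast
    show ?case
      using r r' by (intro exI[of _ "r * r'"]) (simp add: mult.assoc mult.left_commute add.commute)
  qed
  then show ?thesis unfolding n
    by (intro bexI[of _ "(1 + int n) mod 8"]) (simp_all add: dir_mod[symmetric])
qed

section \<open>Arrows at crossings of matching triangles\<close>

locale matched_tiles =
  fixes u :: complex and T :: "triangle set"
  assumes nonzero: "u \<noteq> 0"
    and tile: "t \<in> T \<Longrightarrow> triangular_tile u t"
    and match: "shared_sides_match T"
begin

abbreviation arrows :: "arrow set" where
  "arrows \<equiv> \<Union> (sides ` T)"

lemma arrow_unique: "a \<in> arrows \<Longrightarrow> b \<in> arrows \<Longrightarrow> ends a = ends b \<Longrightarrow> a = b"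
  using match unfolding shared_sides_match_def by blast

lemma leg_dir: "t \<in> T \<Longrightarrow> \<exists>k\<in>{1,3,5,7}. leg t = dir u k"
  using tile unfolding triangular_tile_def quarter_turns_dir by blast

text \<open>Legs run along odd directions and hypotenuses along even ones, so the parity of its
  direction tells which kind of side an arrow is.\<close>

lemma sides_cases:
  assumes "t \<in> T" "a \<in> sides t"
  shows "(\<exists>k. odd k \<and> ends a = {apex t, apex t + dir u k} \<and> (leg t = dir u k \<or> \<i> * leg t = dir u k)) \<or>
         (\<exists>k. even k \<and> apex t + \<i> * leg t = apex t + leg t + dir u k \<and>
            ends a = {apex t + leg t, apex t + \<i> * leg t})"
proof -
  obtain k where k: "k \<in> {1,3,5,7}" "leg t = dir u k" using leg_dir assms by blast
  have i: "\<i> * leg t = dir u (k + 2)" by (simp add: k dir_add_2)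
  have "\<i> * dir u k - dir u k = dir u (k + 3)"
    using k(1) dir_period[of u 0] dir_period[of u 2]
    by (elim insertE emptyE; simp add: dir_values algebra_simps)
  then have h: "apex t + \<i> * leg t = apex t + leg t + dir u (k + 3)" by (simp add: k algebra_simps)
  have "ends a = {apex t, apex t + leg t} \<or> ends a = {apex t, apex t + \<i> * leg t} \<or>
    ends a = {apex t + leg t, apex t + \<i> * leg t}"
    using tile[OF assms(1)] assms(2) unfolding triangular_tile_def by auto
  moreover have "odd k" "odd (k + 2)" "even (k + 3)" using k(1) by auto
  ultimately show ?thesis using h i k(2) by metis
qed

lemma base_side:
  assumes "t \<in> T"
  shows "\<exists>a\<in>sides t. ends a = {apex t + leg t, apex t + \<i> * leg t}"
  using tile[OF assms] unfolding triangular_tile_def by auto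

lemma doubleton_dir:
  assumes "{x, x + dir u k} = {y, y + dir u m}"
  shows "(x = y \<and> k mod 8 = m mod 8) \<or> (y = x + dir u k \<and> x = y + dir u m \<and> (k + 4) mod 8 = m mod 8)"
proof -
  from assms consider "x = y" "x + dir u k = y + dir u m" | "x = y + dir u m" "x + dir u k = y"
    by (auto simp: doubleton_eq_iff)
  then show ?thesis
  proof cases
    case 1
    then show ?thesis using dir_inject nonzero by simp
  next
    case 2
    then have "dir u (k + 4) = dir u m" by (simp add: dir_add_4 add_eq_0_iff add.assoc)
    then show ?thesis using dir_inject nonzero 2 by simp
  qed
qed

lemma parity_mod_8: "(k::int) mod 8 = m mod 8 \<Longrightarrow> even k = even m"
  by (metis dvd_mod_iff even_numeral)

lemma arrow_dir:
  assumes "a \<in> arrows"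
  shows "\<exists>k. head a = tail a + dir u k"
proof -
  obtain t where t: "t \<in> T" "a \<in> sides t" using assms by blast
  then obtain y k where "ends a = {y, y + dir u k}" using sides_cases by metis
  then have "head a = tail a + dir u k \<or> head a = tail a + dir u (k + 4)"
    unfolding ends_def dir_add_4 by (auto simp: doubleton_eq_iff)
  then show ?thesis by blast
qed

text \<open>A crossing prescribes only the ray of an arrow; its length is fixed because every side
  of a tile is one of the steps \<open>dir\<close>.\<close>

lemma enters_arrow:
  assumes "a \<in> arrows" "enters_from x (of_real r * dir u k) a" "0 < r"
  shows "a = Arrow (x + dir u k) x (acolor a)"
proof -
  obtain s where s: "s > 0" "tail a = x + of_real s * (of_real r * dir u k)" "head a = x"
    using assms(2) by (auto simp: enters_from_def)
  obtain m where "head a = tail a + dir u m" using arrow_dir assms(1) by blast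
  then have "of_real (s * r) * dir u k + dir u m = 0" using s by (simp add: mult.assoc)
  then have e: "of_real (s * r) * dir u k = dir u (m + 4)" by (simp add: dir_add_4 eq_neg_iff_add_eq_0)
  have "0 < s * r" using s(1) assms(3) by simp
  from dir_ray_unique[OF nonzero this e] have "tail a = x + dir u k"
    using dir_inject[OF nonzero, of k "m + 4"] s e by (simp add: mult.assoc)
  then show ?thesis using s(3) by (cases a) simp
qed

lemma leaves_arrow:
  assumes "a \<in> arrows" "leaves_towards x (of_real r * dir u k) a" "0 < r"
  shows "a = Arrow x (x + dir u k) (acolor a)"
proof -
  obtain s where s: "s > 0" "head a = x + of_real s * (of_real r * dir u k)" "tail a = x"
    using assms(2) by (auto simp: leaves_towards_def)
  obtain m where "head a = tail a + dir u m" using arrow_dir assms(1) by blast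
  then have e: "of_real (s * r) * dir u k = dir u m" using s by (simp add: mult.assoc)
  have "0 < s * r" using s(1) assms(3) by simp
  from dir_ray_unique[OF nonzero this e] have "head a = x + dir u k"
    using dir_inject[OF nonzero, of k m] s e by (simp add: mult.assoc)
  then show ?thesis using s(3) by (cases a) simp
qed

definition out_at :: "complex \<Rightarrow> int \<Rightarrow> bool" where
  "out_at x k \<longleftrightarrow> (\<exists>c. Arrow x (x + dir u k) c \<in> arrows)"

definition green_at :: "complex \<Rightarrow> int \<Rightarrow> bool" where
  "green_at x k \<longleftrightarrow> (\<exists>a\<in>arrows. ends a = {x, x + dir u k} \<and> acolor a = Green)"

lemma out_atI:
  assumes "Arrow x (x + dir u k) c \<in> arrows"
  shows "out_at x k" "green_at x k \<longleftrightarrow> c = Green"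
proof -
  show "out_at x k" using assms unfolding out_at_def by blast
  have "a = Arrow x (x + dir u k) c" if "a \<in> arrows" "ends a = {x, x + dir u k}" for a
    using arrow_unique[OF that(1) assms] that(2) by (simp add: ends_def)
  then show "green_at x k \<longleftrightarrow> c = Green" using assms unfolding green_at_def
    by (metis arrow.sel ends_def)
qed

lemma not_out_atI:
  assumes "Arrow (x + dir u k) x c \<in> arrows"
  shows "\<not> out_at x k" "green_at x k \<longleftrightarrow> c = Green"
proof -
  have eq: "a = Arrow (x + dir u k) x c" if "a \<in> arrows" "ends a = {x, x + dir u k}" for a
    using arrow_unique[OF that(1) assms] that(2) by (simp add: ends_def insert_commute)
  then show "green_at x k \<longleftrightarrow> c = Green" using assms unfolding green_at_def
    by (metis arrow.sel ends_def insert_commute)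
  show "\<not> out_at x k"
  proof
    assume "out_at x k"
    then obtain c' where "Arrow x (x + dir u k) c' \<in> arrows" unfolding out_at_def by blast
    from eq[OF this] show False using dir_nonzero[OF nonzero] by (simp add: ends_def)
  qed
qed

lemma C8_star:
  assumes "d \<in> eighth_turns u" "C8 x d (crossing T x)"
  shows "\<exists>j\<in>{0..<8}. star j (out_at x) (green_at x)"
    and "\<exists>a\<in>arrows. ends a = {x, x + dir u k}"
proof -
  obtain j r where j: "j \<in> {0..<8}" "r > 0" "d = of_real r * dir u j" using eighth_turns_dir[OF assms(1)] by blast
  obtain r1 r3 r5 r7 where r1: "r1 > 0" "cis (- pi / 4) * dir u (j + 2) = of_real r1 * dir u (j + 2 + 7)"
    and r3: "r3 > 0" "cis (pi / 4) * dir u (j + 2) = of_real r3 * dir u (j + 2 + 1)"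
    and r5: "r5 > 0" "cis (- pi / 4) * dir u (j + 6) = of_real r5 * dir u (j + 6 + 7)"
    and r7: "r7 > 0" "cis (pi / 4) * dir u (j + 6) = of_real r7 * dir u (j + 6 + 1)"
    using cis_rotate_dir by meson
  have d0: "d = of_real r * dir u j" and d4: "- d = of_real r * dir u (j + 4)"
    and d2: "\<i> * d = of_real r * dir u (j + 2)" and d6: "- \<i> * d = of_real r * dir u (j + 6)"
    by (simp_all add: j(3) dir_add_4 dir_add_2 dir_add_6)
  have p1: "dir u (j + 2 + 7) = dir u (j + 1)" "dir u (j + 6 + 7) = dir u (j + 5)"
    using dir_period[of u "j + 1"] dir_period[of u "j + 5"] by (simp_all add: add.assoc)
  have d1: "cis (- pi / 4) * (\<i> * d) = of_real (r * r1) * dir u (j + 1)"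
    and d3: "cis (pi / 4) * (\<i> * d) = of_real (r * r3) * dir u (j + 3)"
    and d5: "cis (- pi / 4) * (- \<i> * d) = of_real (r * r5) * dir u (j + 5)"
    and d7: "cis (pi / 4) * (- \<i> * d) = of_real (r * r7) * dir u (j + 7)"
    unfolding d2 d6 using r1 r3 r5 r7 p1 by (simp_all add: mult.left_commute mult.assoc add.assoc)
  have pos: "0 < r * r1" "0 < r * r3" "0 < r * r5" "0 < r * r7" using j(2) r1 r3 r5 r7 by simp_all
  obtain a b p q g h g' h' where A: "crossing T x = {a, b, p, q, g, h, g', h'}"
     and e: "enters_from x (- d) a" "leaves_towards x d b" "acolor a = acolor b"
     "enters_from x (\<i> * d) p" "enters_from x (- \<i> * d) q" "acolor p \<noteq> acolor q"
     "leaves_towards x (cis (pi / 4) * (\<i> * d)) g" "acolor g = Green"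
     "leaves_towards x (cis (- pi / 4) * (\<i> * d)) h" "acolor h = Red"
     "leaves_towards x (cis (pi / 4) * (- \<i> * d)) g'" "acolor g' = Green"
     "leaves_towards x (cis (- pi / 4) * (- \<i> * d)) h'" "acolor h' = Red"
    using assms(2) unfolding C8_def by (elim exE conjE) (rule that)
  have m: "a \<in> arrows" "b \<in> arrows" "p \<in> arrows" "q \<in> arrows" "g \<in> arrows" "h \<in> arrows" "g' \<in> arrows" "h' \<in> arrows"
    using A unfolding crossing_def by blast+
  have a4: "Arrow (x + dir u (j + 4)) x (acolor a) \<in> arrows"
    and a0: "Arrow x (x + dir u j) (acolor b) \<in> arrows"
    and a2: "Arrow (x + dir u (j + 2)) x (acolor p) \<in> arrows"
    and a6: "Arrow (x + dir u (j + 6)) x (acolor q) \<in> arrows"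
    and a3: "Arrow x (x + dir u (j + 3)) (acolor g) \<in> arrows"
    and a1: "Arrow x (x + dir u (j + 1)) (acolor h) \<in> arrows"
    and a7: "Arrow x (x + dir u (j + 7)) (acolor g') \<in> arrows"
    and a5: "Arrow x (x + dir u (j + 5)) (acolor h') \<in> arrows"
    using enters_arrow[OF m(1) e(1)[unfolded d4] j(2)] leaves_arrow[OF m(2) e(2)[unfolded d0] j(2)]
      enters_arrow[OF m(3) e(4)[unfolded d2] j(2)] enters_arrow[OF m(4) e(5)[unfolded d6] j(2)]
      leaves_arrow[OF m(5) e(7)[unfolded d3] pos(2)] leaves_arrow[OF m(6) e(9)[unfolded d1] pos(1)]
      leaves_arrow[OF m(7) e(11)[unfolded d7] pos(4)] leaves_arrow[OF m(8) e(13)[unfolded d5] pos(3)] m by metis+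
  have "star j (out_at x) (green_at x)"
    unfolding star_def
    using not_out_atI[OF a4] out_atI[OF a0] not_out_atI[OF a2] not_out_atI[OF a6] out_atI[OF a3]
      out_atI[OF a1] out_atI[OF a7] out_atI[OF a5] e by (metis color.exhaust color.distinct(1))
  then show "\<exists>j\<in>{0..<8}. star j (out_at x) (green_at x)" using j(1) by blast
  have "(k - j) mod 8 \<in> {0,1,2,3,4,5,6,7}" by (rule mod_8_cases)
  moreover have "dir u k = dir u (j + (k - j) mod 8)"
    using dir_mod[of u k] dir_mod[of u "j + (k - j) mod 8"] by (simp add: mod_simps)
  ultimately have "dir u k \<in> {dir u j, dir u (j + 1), dir u (j + 2), dir u (j + 3), dir u (j + 4), dir u (j + 5),
      dir u (j + 6), dir u (j + 7)}" by auto
  moreover have "\<exists>a\<in>arrows. ends a = {x, y}" if "Arrow x y c \<in> arrows \<or> Arrow y x c \<in> arrows" for y c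
    using that
  proof
    assume "Arrow x y c \<in> arrows"
    then show ?thesis by (rule bexI[rotated]) (simp add: ends_def)
  next
    assume "Arrow y x c \<in> arrows"
    then show ?thesis by (rule bexI[rotated]) (simp add: ends_def insert_commute)
  qed
  note this[OF disjI1, OF a0] this[OF disjI1, OF a1] this[OF disjI2, OF a2] this[OF disjI1, OF a3]
    this[OF disjI2, OF a4] this[OF disjI1, OF a5] this[OF disjI2, OF a6] this[OF disjI1, OF a7]
  ultimately show "\<exists>a\<in>arrows. ends a = {x, x + dir u k}"
    by (elim insertE emptyE) simp_all
qed

lemma C4_arrows:
  assumes "C4 x (dir u m) (crossing T x)"
  shows "\<exists>c. Arrow (x + dir u (m + 4)) x c \<in> arrows \<and> Arrow x (x + dir u m) c \<in> arrows"
    and "\<exists>c. Arrow (x + dir u (m + 2)) x c \<in> arrows"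
    and "\<exists>c. Arrow (x + dir u (m + 6)) x c \<in> arrows"
    and "a \<in> arrows \<Longrightarrow> x \<in> ends a \<Longrightarrow> \<exists>k\<in>{m, m + 2, m + 4, m + 6}. ends a = {x, x + dir u k}"
proof -
  obtain b c p q where A: "crossing T x = {b, c, p, q}"
    and e: "enters_from x (- dir u m) b" "leaves_towards x (dir u m) c" "acolor b = acolor c"
      "enters_from x (\<i> * dir u m) p" "enters_from x (- \<i> * dir u m) q"
    using assms unfolding C4_def by (elim exE conjE) (rule that)
  have m: "b \<in> arrows" "c \<in> arrows" "p \<in> arrows" "q \<in> arrows"
    using A unfolding crossing_def by blast+
  have a: "b = Arrow (x + dir u (m + 4)) x (acolor b)" "c = Arrow x (x + dir u m) (acolor b)"
    "p = Arrow (x + dir u (m + 2)) x (acolor p)" "q = Arrow (x + dir u (m + 6)) x (acolor q)"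
    using enters_arrow[of b x 1 "m + 4"] leaves_arrow[of c x 1 m] enters_arrow[of p x 1 "m + 2"]
      enters_arrow[of q x 1 "m + 6"] m e
    by (simp_all add: dir_add_2 dir_add_4 dir_add_6)
  show "\<exists>c. Arrow (x + dir u (m + 4)) x c \<in> arrows \<and> Arrow x (x + dir u m) c \<in> arrows"
    "\<exists>c. Arrow (x + dir u (m + 2)) x c \<in> arrows"
    "\<exists>c. Arrow (x + dir u (m + 6)) x c \<in> arrows" using a m by metis+
  show "\<exists>k\<in>{m, m + 2, m + 4, m + 6}. ends a = {x, x + dir u k}" if "a \<in> arrows" "x \<in> ends a"
  proof -
    have "a \<in> {b, c, p, q}" using that A unfolding crossing_def by blast
    moreover have "ends b = {x, x + dir u (m + 4)}" "ends c = {x, x + dir u m}"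
      "ends p = {x, x + dir u (m + 2)}" "ends q = {x, x + dir u (m + 6)}"
      by (subst a, simp add: ends_def insert_commute)+
    ultimately have "ends a = {x, x + dir u (m + 4)} \<or> ends a = {x, x + dir u m} \<or>
        ends a = {x, x + dir u (m + 2)} \<or> ends a = {x, x + dir u (m + 6)}"
      by (elim insertE emptyE) simp_all
    then show ?thesis by blast
  qed
qed

lemma C4_no_diagonal:
  assumes "d \<in> quarter_turns u" "C4 x d (crossing T x)" "a \<in> arrows" "ends a = {x, x + dir u k}"
  shows "odd k"
proof -
  obtain m where "m \<in> {1,3,5,7}" "d = dir u m" using assms(1) unfolding quarter_turns_dir by blast
  then have m: "odd m" "d = dir u m" by auto
  obtain n where n: "n \<in> {m, m + 2, m + 4, m + 6}" "ends a = {x, x + dir u n}"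
    using C4_arrows(4) assms m by (metis insertI1)
  have "odd n" using n(1) m(1) by auto
  moreover have "k mod 8 = n mod 8 \<or> (k + 4) mod 8 = n mod 8"
    using doubleton_dir n(2) assms(4) by metis
  ultimately show ?thesis using parity_mod_8[of k n] parity_mod_8[of "k + 4" n] by auto
qed

lemma not_C4_and_C8:
  assumes "d \<in> quarter_turns u" "C4 x d (crossing T x)" "d' \<in> eighth_turns u" "C8 x d' (crossing T x)"
  shows False
  using C8_star(2)[OF assms(3,4), of 0] C4_no_diagonal[OF assms(1,2), of _ 0] by auto

end

section \<open>The grid of a tiling\<close>

text \<open>The ends of hypotenuses; they will be the corners of the squares, whereas the apexes are
  the centers.\<close>

definition base_vertices :: "triangle set \<Rightarrow> complex set" where
  "base_vertices T = (\<Union>t\<in>T. {apex t + leg t, apex t + \<i> * leg t})"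

lemma base_verticesI:
  "t \<in> T \<Longrightarrow> apex t + leg t \<in> base_vertices T" "t \<in> T \<Longrightarrow> apex t + \<i> * leg t \<in> base_vertices T"
  unfolding base_vertices_def by blast+

lemma mem_triangle_hull:
  assumes "0 \<le> p" "0 \<le> q" "p + q \<le> 1"
  shows "a + of_real p * l + of_real q * (\<i> * l) \<in> convex hull {a, a + l, a + \<i> * l}"
proof -
  have "a + of_real p * l + of_real q * (\<i> * l) =
      (1 - p - q) *\<^sub>R a + p *\<^sub>R (a + l) + q *\<^sub>R (a + \<i> * l)"
    by (simp add: scaleR_conv_of_real algebra_simps)
  then show ?thesis unfolding convex_hull_3 using assms by (intro CollectI exI[of _ "1 - p - q"] exI[of _ p] exI[of _ q]) auto
qed

text \<open>Common ground of both kinds of tilings. \<open>base_in_tile\<close> carries what is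
  still needed of the polygons: it will keep all base vertices on one lattice.\<close>

locale crossing_tiling = matched_tiles +
  assumes nonempty: "T \<noteq> {}"
    and differ: "neighbours_differ T"
    and apex_C4: "t \<in> T \<Longrightarrow> \<exists>d\<in>quarter_turns u. C4 (apex t) d (crossing T (apex t)) \<and>
                     red_left_green_right T (apex t) d"
    and base_C8: "x \<in> base_vertices T \<Longrightarrow> \<exists>d\<in>eighth_turns u. C8 x d (crossing T x)"
    and base_in_tile: "x \<in> base_vertices T \<Longrightarrow> t \<in> T \<Longrightarrow> x \<in> convex hull triangle_vertices t \<Longrightarrow>
                     x - apex t \<in> quarter_turns u"
begin

lemma base_arrow: "x \<in> base_vertices T \<Longrightarrow> \<exists>a\<in>arrows. ends a = {x, x + dir u k}"
  using base_C8 C8_star(2) by blast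

lemma apex_not_base: "t \<in> T \<Longrightarrow> apex t \<notin> base_vertices T"
  using apex_C4 base_C8 not_C4_and_C8 by blast

lemma base_even:
  assumes "x \<in> base_vertices T" "even k"
  shows "x + dir u k \<in> base_vertices T"
proof -
  obtain a t where a: "t \<in> T" "a \<in> sides t" "ends a = {x, x + dir u k}"
    using base_arrow[OF assms(1)] by blast
  have "\<not> (odd m \<and> ends a = {apex t, apex t + dir u m})" for m
    using doubleton_dir[of x k "apex t" m] a(3) assms(2) parity_mod_8[of k m] parity_mod_8[of "k + 4" m] by auto
  then have "ends a = {apex t + leg t, apex t + \<i> * leg t}" using sides_cases[OF a(1,2)] by blast
  then show ?thesis using a(1,3) unfolding base_vertices_def by blast
qed

lemma base_odd:
  assumes "x \<in> base_vertices T" "odd k"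
  shows "\<exists>t\<in>T. apex t = x + dir u k"
proof -
  obtain a t where a: "t \<in> T" "a \<in> sides t" "ends a = {x, x + dir u k}"
    using base_arrow[OF assms(1)] by blast
  have "\<not> (even m \<and> ends a = {y, y + dir u m})" for m y
    using doubleton_dir[of x k y m] a(3) assms(2) parity_mod_8[of k m] parity_mod_8[of "k + 4" m] by auto
  then have "apex t \<in> ends a" using sides_cases[OF a(1,2)] by (metis insertI1)
  then show ?thesis using a(1,3) apex_not_base assms(1) by auto
qed

text \<open>Along \<open>p\<close> one faces \<open>- dir u k\<close>, so the left-hand side is that
  of \<open>- \<i> * dir u k\<close>. As \<open>leg t\<close> is the clockwise leg, it points there
  for the tile on the left and along \<open>p\<close> for the tile on the right. A tile with another
  apex would make \<open>x\<close> a base vertex.\<close>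

lemma flanking_tiles:
  assumes "t0 \<in> T" "apex t0 = x" "odd k" "p \<in> arrows" "p = Arrow (x + dir u k) x c" "t \<in> T" "p \<in> sides t"
  shows "apex t = x" "on_left p t \<Longrightarrow> leg t = - \<i> * dir u k" "on_right p t \<Longrightarrow> leg t = dir u k"
proof -
  have e: "ends p = {x, x + dir u k}" using assms(5) by (auto simp: ends_def)
  have "\<not> (even m \<and> ends p = {y, y + dir u m})" for m y
    using doubleton_dir[of x k y m] e assms(3) parity_mod_8[of k m] parity_mod_8[of "k + 4" m] by auto
  then obtain m where m: "ends p = {apex t, apex t + dir u m}" "leg t = dir u m \<or> \<i> * leg t = dir u m"
    using sides_cases[OF assms(6,7)] by metis
  have "apex t + dir u m \<in> base_vertices T" using m(2) base_verticesI[OF assms(6)] by metis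
  then have "apex t + dir u m \<noteq> x" using apex_not_base assms(1,2) by metis
  then show x: "apex t = x" using m(1) e by (metis doubleton_eq_iff)
  then have "dir u m = dir u k" using m(1) e by (auto simp: doubleton_eq_iff)
  then consider "leg t = dir u k" | "leg t = - \<i> * dir u k"
    using m(2) by (metis complex_i_mult_minus minus_minus mult_minus_left)
  note cases = this
  let ?e = "dir u k"
  have n: "?e \<noteq> 0" using dir_nonzero nonzero by blast
  then have pos: "(Re ?e)\<^sup>2 + (Im ?e)\<^sup>2 > 0" by (simp add: complex_eq_iff sum_power2_gt_zero_iff)
  show "leg t = - \<i> * ?e" if "on_left p t"
  proof (rule cases)
    assume "leg t = ?e"
    then have "x + \<i> * ?e \<in> triangle_vertices t" using x by (simp add: triangle_vertices_def)
    then have "Im (cnj (- ?e) * (\<i> * ?e - ?e)) \<ge> 0"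
      using that assms(5) unfolding on_left_def by force
    then have "- ((Re ?e)\<^sup>2 + (Im ?e)\<^sup>2) \<ge> 0" by (simp add: power2_eq_square algebra_simps)
    then show ?thesis using pos by simp
  qed
  show "leg t = ?e" if "on_right p t"
  proof (rule cases)
    assume "leg t = - \<i> * ?e"
    then have "x + - \<i> * ?e \<in> triangle_vertices t" using x by (simp add: triangle_vertices_def)
    then have "Im (cnj (- ?e) * (- \<i> * ?e - ?e)) \<le> 0"
      using that assms(5) unfolding on_right_def by force
    then have "((Re ?e)\<^sup>2 + (Im ?e)\<^sup>2) \<le> 0" by (simp add: power2_eq_square algebra_simps)
    then show ?thesis using pos by simp
  qed
qed

text \<open>The two perpendicular arrows each have a red tile on the left and a green one on the
  right. This produces all four tiles around the apex, and their colours encode the axis.\<close>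

lemma tiles_around_apex:
  assumes "t0 \<in> T"
  shows "\<exists>m\<in>{1,3,5,7}. C4 (apex t0) (dir u m) (crossing T (apex t0)) \<and>
           (\<forall>l\<in>quarter_turns u. \<exists>t\<in>T. apex t = apex t0 \<and> leg t = l \<and>
              (tcolor t = Red \<longleftrightarrow> l = dir u m \<or> l = - dir u m))"
proof -
  let ?x = "apex t0"
  obtain d where "d \<in> quarter_turns u" and C: "C4 ?x d (crossing T ?x)" "red_left_green_right T ?x d"
    using apex_C4[OF assms] by blast
  then obtain m where m: "m \<in> {1,3,5,7}" "d = dir u m" unfolding quarter_turns_dir by blast
  note C = C[unfolded m(2)]
  have odd: "odd (m + 2)" "odd (m + 6)" using m(1) by auto
  have key: "(\<exists>t\<in>T. apex t = ?x \<and> leg t = - \<i> * dir u k \<and> tcolor t = Red) \<and>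
      (\<exists>t\<in>T. apex t = ?x \<and> leg t = dir u k \<and> tcolor t = Green)"
    if k: "odd k" "Arrow (?x + dir u k) ?x c \<in> arrows" "dir u k = \<i> * dir u m \<or> dir u k = - \<i> * dir u m" for k c
  proof -
    let ?p = "Arrow (?x + dir u k) ?x c"
    have "?p \<in> crossing T ?x" using k(2) by (simp add: crossing_def ends_def)
    moreover have "enters_from ?x (dir u k) ?p"
      unfolding enters_from_def by (auto intro!: exI[of _ 1])
    ultimately have "(\<exists>t\<in>T. ?p \<in> sides t \<and> on_left ?p t \<and> tcolor t = Red) \<and>
        (\<exists>t\<in>T. ?p \<in> sides t \<and> on_right ?p t \<and> tcolor t = Green)"
      using C(2) k(3) unfolding red_left_green_right_def by metis
    then show ?thesis using flanking_tiles[OF assms refl k(1,2) refl] by metis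
  qed
  obtain c2 c6 where a2: "Arrow (?x + dir u (m + 2)) ?x c2 \<in> arrows" and a6: "Arrow (?x + dir u (m + 6)) ?x c6 \<in> arrows"
    using C4_arrows(2,3)[OF C(1)] by blast
  note key2 = key[OF odd(1) a2] and key6 = key[OF odd(2) a6]
  have red: "\<exists>t\<in>T. apex t = ?x \<and> leg t = l \<and> tcolor t = Red" if "l = dir u m \<or> l = - dir u m" for l
    using key2 key6 that by (auto simp: dir_add_2 dir_add_6)
  have green: "\<exists>t\<in>T. apex t = ?x \<and> leg t = l \<and> tcolor t = Green" if "l = \<i> * dir u m \<or> l = - \<i> * dir u m" for l
    using key2 key6 that by (auto simp: dir_add_2 dir_add_6)
  have "\<exists>t\<in>T. apex t = ?x \<and> leg t = l \<and> (tcolor t = Red \<longleftrightarrow> l = dir u m \<or> l = - dir u m)"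
    if "l \<in> quarter_turns u" for l
  proof (cases "l = dir u m \<or> l = - dir u m")
    case True
    then show ?thesis using red by metis
  next
    case False
    then have "l = \<i> * dir u m \<or> l = - \<i> * dir u m"
      using that m(1) unfolding quarter_turns_dir by (auto simp: dir_values mult.commute[of u \<i>])
    then show ?thesis using green False by (metis color.distinct(1))
  qed
  then show ?thesis using m(1) C(1) by blast
qed

lemma tiles_across_base:
  assumes "s \<in> T" "t \<in> T" "apex t = apex s + (1 + \<i>) * l" "leg s = l" "leg t = - l"
  shows "tcolor s \<noteq> tcolor t"
proof -
  have "l \<noteq> 0" using leg_dir[OF assms(1)] dir_nonzero[OF nonzero] assms(4) by auto
  moreover have "1 + \<i> \<noteq> 0" by (simp add: complex_eq_iff)
  ultimately have "s \<noteq> t" using assms(3) by auto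
  moreover obtain a where a: "a \<in> sides s" "ends a = {apex s + leg s, apex s + \<i> * leg s}"
    using base_side assms(1) by blast
  moreover obtain b where b: "b \<in> sides t" "ends b = {apex t + leg t, apex t + \<i> * leg t}"
    using base_side assms(2) by blast
  moreover have "apex t + leg t = apex s + \<i> * leg s" "apex t + \<i> * leg t = apex s + leg s"
    using assms by (simp_all add: algebra_simps)
  then have "ends a = ends b" using a b by auto
  ultimately show ?thesis using differ assms unfolding neighbours_differ_def by blast
qed

lemma base_origin: "\<exists>x0. x0 \<in> base_vertices T"
  using nonempty base_verticesI by blast

end

section \<open>The lattice of corners and its grid of arrows\<close>

locale based_tiling = crossing_tiling +
  fixes x0 :: complex
  assumes x0: "x0 \<in> base_vertices T"
begin

definition pos :: "int \<Rightarrow> int \<Rightarrow> complex" where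
  "pos x y = x0 + of_int x * dir u 0 + of_int y * dir u 2"

lemma pos_step: "pos (x + 1) y = pos x y + dir u 0" "pos x (y + 1) = pos x y + dir u 2"
  by (simp_all add: pos_def algebra_simps)

lemma pos_base: "pos x y \<in> base_vertices T"
proof -
  have prev: "z - dir u k \<in> base_vertices T" if "z \<in> base_vertices T" "even k" for z k
    using base_even[OF that(1), of "k + 4"] that(2) by (simp add: dir_add_4)
  have "pos x 0 \<in> base_vertices T"
  proof (induction x rule: int_induct[where k = 0])
    case base
    show ?case using x0 by (simp add: pos_def)
  next
    case (step1 i)
    then show ?case using base_even[of "pos i 0" 0] by (simp add: pos_step)
  next
    case (step2 i)
    then show ?case using prev[of "pos i 0" 0] pos_step(1)[of "i - 1" 0] by simp
  qed
  then show ?thesis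
  proof (induction y rule: int_induct[where k = 0])
    case base
    then show ?case .
  next
    case (step1 i)
    then show ?case using base_even[of "pos x i" 2] by (simp add: pos_step)
  next
    case (step2 i)
    then show ?case using prev[of "pos x i" 2] pos_step(2)[of x "i - 1"] by simp
  qed
qed

definition mid :: "int \<Rightarrow> int \<Rightarrow> complex" where
  "mid x y = pos x y + dir u 1"

lemma corners:
  "pos x y = mid x y + dir u 5" "pos (x + 1) y = mid x y + dir u 7"
  "pos (x + 1) (y + 1) = mid x y + dir u 1" "pos x (y + 1) = mid x y + dir u 3"
  by (simp_all add: mid_def pos_def dir_values algebra_simps)

definition axis :: "int \<Rightarrow> int \<Rightarrow> int" where
  "axis x y = (SOME m. m \<in> {1,3,5,7} \<and> C4 (mid x y) (dir u m) (crossing T (mid x y)) \<and>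
           (\<forall>l\<in>quarter_turns u. \<exists>t\<in>T. apex t = mid x y \<and> leg t = l \<and>
              (tcolor t = Red \<longleftrightarrow> l = dir u m \<or> l = - dir u m)))"

lemma axis:
  "axis x y \<in> {1,3,5,7}" "C4 (mid x y) (dir u (axis x y)) (crossing T (mid x y))"
  "l \<in> quarter_turns u \<Longrightarrow> \<exists>t\<in>T. apex t = mid x y \<and> leg t = l \<and>
              (tcolor t = Red \<longleftrightarrow> l = dir u (axis x y) \<or> l = - dir u (axis x y))"
proof -
  have "odd (1::int)" by simp
  from base_odd[OF pos_base this] obtain t where "t \<in> T" "apex t = mid x y"
    unfolding mid_def by metis
  then have "\<exists>m. m \<in> {1,3,5,7} \<and> C4 (mid x y) (dir u m) (crossing T (mid x y)) \<and>
           (\<forall>l\<in>quarter_turns u. \<exists>t\<in>T. apex t = mid x y \<and> leg t = l \<and>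
              (tcolor t = Red \<longleftrightarrow> l = dir u m \<or> l = - dir u m))"
    using tiles_around_apex by metis
  from someI_ex[OF this]
  show "axis x y \<in> {1,3,5,7}" "C4 (mid x y) (dir u (axis x y)) (crossing T (mid x y))"
  "l \<in> quarter_turns u \<Longrightarrow> \<exists>t\<in>T. apex t = mid x y \<and> leg t = l \<and>
              (tcolor t = Red \<longleftrightarrow> l = dir u (axis x y) \<or> l = - dir u (axis x y))"
    unfolding axis_def by blast+
qed

text \<open>The tiles with legs \<open>l\<close> and \<open>- l\<close> of the two squares share a
  hypotenuse, so exactly one is red; and redness says that \<open>l\<close> lies on the axis of its
  square.\<close>

lemma axis_step:
  assumes "l \<in> quarter_turns u" "mid x' y' = mid x y + (1 + \<i>) * l"
  shows "(l = dir u (axis x y) \<or> l = - dir u (axis x y)) \<noteq>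
         (l = dir u (axis x' y') \<or> l = - dir u (axis x' y'))"
proof -
  have ml: "- l \<in> quarter_turns u" using assms(1) unfolding quarter_turns_dir by (auto simp: dir_values)
  obtain s where s: "s \<in> T" "apex s = mid x y" "leg s = l"
    "tcolor s = Red \<longleftrightarrow> l = dir u (axis x y) \<or> l = - dir u (axis x y)"
    using axis(3)[OF assms(1)] by blast
  obtain t where t: "t \<in> T" "apex t = mid x' y'" "leg t = - l"
    "tcolor t = Red \<longleftrightarrow> - l = dir u (axis x' y') \<or> - l = - dir u (axis x' y')"
    using axis(3)[OF ml] by blast
  have "tcolor s \<noteq> tcolor t" by (rule tiles_across_base[OF s(1) t(1)]) (use assms s t in simp_all)
  then have "(tcolor s = Red) \<noteq> (tcolor t = Red)" using color.exhaust by metis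
  moreover have "- l = e \<longleftrightarrow> l = - e" for e by (metis minus_minus)
  ultimately show ?thesis using s(4) t(4) by simp argo
qed

lemma axis_alternates:
  "(axis x y \<in> {1,5}) \<noteq> (axis (x + 1) y \<in> {1,5})" "(axis x y \<in> {1,5}) \<noteq> (axis x (y + 1) \<in> {1,5})"
proof -
  have q: "u \<in> quarter_turns u" "- \<i> * u \<in> quarter_turns u"
    unfolding quarter_turns_dir by (auto simp: dir_values)
  have f: "u = dir u m \<longleftrightarrow> 1 mod 8 = m mod 8" "u = - dir u m \<longleftrightarrow> 1 mod 8 = (m + 4) mod 8"
    "- \<i> * u = dir u m \<longleftrightarrow> 7 mod 8 = m mod 8" "- \<i> * u = - dir u m \<longleftrightarrow> 7 mod 8 = (m + 4) mod 8" for m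
    using dir_inject[OF nonzero, of 1 m] dir_inject[OF nonzero, of 1 "m + 4"]
      dir_inject[OF nonzero, of 7 m] dir_inject[OF nonzero, of 7 "m + 4"]
    by (simp_all add: dir_values dir_add_4 mult.commute)
  have a: "(u = dir u m \<or> u = - dir u m) \<longleftrightarrow> m \<in> {1,5}"
    "(- \<i> * u = dir u m \<or> - \<i> * u = - dir u m) \<longleftrightarrow> \<not> m \<in> {1,5}" if "m \<in> {1,3,5,7}" for m
    unfolding f using that by (elim insertE emptyE; simp)+
  have "mid (x + 1) y = mid x y + (1 + \<i>) * (- \<i> * u)"
    by (simp add: mid_def pos_def dir_values algebra_simps)
  from axis_step[OF q(2) this] show "(axis x y \<in> {1,5}) \<noteq> (axis (x + 1) y \<in> {1,5})"
    unfolding a(2)[OF axis(1)] by blast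
  have "mid x (y + 1) = mid x y + (1 + \<i>) * u"
    by (simp add: mid_def pos_def dir_values algebra_simps)
  from axis_step[OF q(1) this] show "(axis x y \<in> {1,5}) \<noteq> (axis x (y + 1) \<in> {1,5})"
    unfolding a(1)[OF axis(1)] by blast
qed

lemma edge_arrow:
  assumes "x \<in> base_vertices T"
  shows "out_at x k \<noteq> out_at (x + dir u k) (k + 4)" "green_at x k = green_at (x + dir u k) (k + 4)"
proof -
  have b: "x + dir u k + dir u (k + 4) = x" by (simp add: dir_add_4)
  obtain a where a: "a \<in> arrows" "ends a = {x, x + dir u k}" using base_arrow[OF assms] by blast
  then have "a = Arrow x (x + dir u k) (acolor a) \<or> a = Arrow (x + dir u k) x (acolor a)"
    by (cases a) (auto simp: ends_def doubleton_eq_iff)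
  then show "out_at x k \<noteq> out_at (x + dir u k) (k + 4)" "green_at x k = green_at (x + dir u k) (k + 4)"
    using out_atI[of x k "acolor a"] not_out_atI[of x k "acolor a"] out_atI[of "x + dir u k" "k + 4" "acolor a"]
      not_out_atI[of "x + dir u k" "k + 4" "acolor a"] a(1) unfolding b by metis+
qed

lemma corner_arrow:
  assumes "n' mod 8 = (n + 4) mod 8"
  shows "Arrow (z + dir u n) z c \<in> arrows \<Longrightarrow> out_at (z + dir u n) n' \<and> (green_at (z + dir u n) n' \<longleftrightarrow> c = Green)"
    "Arrow z (z + dir u n) c \<in> arrows \<Longrightarrow> \<not> out_at (z + dir u n) n' \<and> (green_at (z + dir u n) n' \<longleftrightarrow> c = Green)"
proof -
  have "dir u n' = dir u (n + 4)" using dir_inject[OF nonzero] assms by blast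
  then have "z + dir u n + dir u n' = z" by (simp add: dir_add_4)
  then show "Arrow (z + dir u n) z c \<in> arrows \<Longrightarrow> out_at (z + dir u n) n' \<and> (green_at (z + dir u n) n' \<longleftrightarrow> c = Green)"
    "Arrow z (z + dir u n) c \<in> arrows \<Longrightarrow> \<not> out_at (z + dir u n) n' \<and> (green_at (z + dir u n) n' \<longleftrightarrow> c = Green)"
    using out_atI[of "z + dir u n" n' c] not_out_atI[of "z + dir u n" n' c] by metis+
qed

lemma hub_arrows:
  "if axis x y \<in> {1,5}
   then out_at (pos x y) 1 \<noteq> out_at (pos (x + 1) (y + 1)) 5 \<and>
        green_at (pos x y) 1 = green_at (pos (x + 1) (y + 1)) 5 \<and>
        out_at (pos (x + 1) y) 3 \<and> out_at (pos x (y + 1)) 7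
   else out_at (pos (x + 1) y) 3 \<noteq> out_at (pos x (y + 1)) 7 \<and>
        green_at (pos (x + 1) y) 3 = green_at (pos x (y + 1)) 7 \<and>
        out_at (pos x y) 1 \<and> out_at (pos (x + 1) (y + 1)) 5"
proof -
  let ?z = "mid x y" and ?m = "axis x y"
  obtain c c2 c6 where a: "Arrow (?z + dir u (?m + 4)) ?z c \<in> arrows" "Arrow ?z (?z + dir u ?m) c \<in> arrows"
    "Arrow (?z + dir u (?m + 2)) ?z c2 \<in> arrows" "Arrow (?z + dir u (?m + 6)) ?z c6 \<in> arrows"
    using C4_arrows(1,2,3)[OF axis(2)] by metis
  have p: "dir u 9 = dir u 1" "dir u 11 = dir u 3" "dir u 13 = dir u 5"
    using dir_period[of u 1] dir_period[of u 3] dir_period[of u 5] by simp_all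
  consider "?m = 1" | "?m = 3" | "?m = 5" | "?m = 7" using axis(1) by blast
  then show ?thesis
  proof cases
    case 1
    then show ?thesis unfolding corners[of x y]
      using corner_arrow(1)[of 1 5 ?z c] corner_arrow(2)[of 5 1 ?z c] corner_arrow(1)[of 7 3 ?z c2]
        corner_arrow(1)[of 3 7 ?z c6] a by simp
  next
    case 2
    then show ?thesis unfolding corners[of x y]
      using corner_arrow(1)[of 3 7 ?z c] corner_arrow(2)[of 7 3 ?z c] corner_arrow(1)[of 1 5 ?z c2]
        corner_arrow(1)[of 5 1 ?z c6] a by (simp add: p)
  next
    case 3
    then show ?thesis unfolding corners[of x y]
      using corner_arrow(1)[of 5 1 ?z c] corner_arrow(2)[of 1 5 ?z c] corner_arrow(1)[of 3 7 ?z c2]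
        corner_arrow(1)[of 7 3 ?z c6] a by (simp add: p)
  next
    case 4
    then show ?thesis unfolding corners[of x y]
      using corner_arrow(1)[of 7 3 ?z c] corner_arrow(2)[of 3 7 ?z c] corner_arrow(1)[of 5 1 ?z c2]
        corner_arrow(1)[of 1 5 ?z c6] a by (simp add: p)
  qed
qed

lemma arrow_grid_at: "arrow_grid (\<lambda>x y. out_at (pos x y)) (\<lambda>x y. green_at (pos x y))"
proof (standard, goal_cases)
  case (3 x y)
  show ?case using C8_star(1) base_C8[OF pos_base] by blast
next
  case (8 x y)
  show ?case using hub_arrows[of x y] by (simp split: if_splits)
qed (use edge_arrow[OF pos_base, of _ _ 0] edge_arrow[OF pos_base, of _ _ 2] in
    \<open>simp_all add: out_at_def green_at_def dir_period pos_step\<close>)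

lemma checkered_grid_at: "\<exists>c. checkered_grid (\<lambda>x y. out_at (pos x y)) (\<lambda>x y. green_at (pos x y)) c"
proof -
  interpret arrow_grid "\<lambda>x y. out_at (pos x y)" "\<lambda>x y. green_at (pos x y)"
    by (rule arrow_grid_at)
  have "axis_SWNE x y \<longleftrightarrow> axis x y \<in> {1,5}" for x y
    using hub_arrows[of x y] unfolding axis_SWNE_def by (auto split: if_splits)
  then have "\<exists>c. \<forall>x y. axis_SWNE x y \<longleftrightarrow> even (x + y + c)"
    using checkered_if_alternating[of axis_SWNE] axis_alternates by metis
  then show ?thesis
    using arrow_grid_axioms by (auto simp: checkered_grid_def checkered_grid_axioms_def)
qed

end

context based_tiling
begin

lemma tile_containing: "\<exists>t\<in>T. \<exists>m n. apex t = mid m n \<and> x \<in> convex hull triangle_vertices t"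
proof -
  define z where "z = (x - x0) / dir u 0"
  define m n where "m = \<lfloor>Re z\<rfloor>" and "n = \<lfloor>Im z\<rfloor>"
  define a b where "a = Re z - of_int m" and "b = Im z - of_int n"
  have ab: "0 \<le> a" "a \<le> 1" "0 \<le> b" "b \<le> 1" unfolding a_def b_def m_def n_def by linarith+
  have d2: "dir u 2 = \<i> * dir u 0" by (simp add: dir_values algebra_simps)
  have "x = x0 + z * dir u 0" unfolding z_def using dir_nonzero[OF nonzero] by simp
  also have "z = (of_int m + of_real a) + \<i> * (of_int n + of_real b)"
    by (simp add: complex_eq_iff a_def b_def)
  finally have "x = pos m n + of_real a * dir u 0 + of_real b * dir u 2"
    unfolding pos_def d2 by (simp add: algebra_simps)
  \<comment> \<open>In coordinates centered in the unit cell, the signs of \<open>a + b - 1\<close>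
    and \<open>b - a\<close> select the quarter containing the point.\<close>
  then have x: "x = mid m n + of_real (a + b - 1) * u + of_real (b - a) * (\<i> * u)"
    by (simp add: mid_def dir_values algebra_simps)
  have main: "\<exists>t\<in>T. apex t = mid m n \<and> x \<in> convex hull triangle_vertices t"
    if l: "l \<in> quarter_turns u" and pq: "0 \<le> p" "0 \<le> q" "p + q \<le> 1"
      and x: "x = mid m n + of_real p * l + of_real q * (\<i> * l)" for l p q
  proof -
    obtain t where "t \<in> T" "apex t = mid m n" "leg t = l" using axis(3)[OF l] by blast
    moreover from this have "x \<in> convex hull triangle_vertices t"
      using mem_triangle_hull[OF pq, of "mid m n" l] x by (simp add: triangle_vertices_def)
    ultimately show ?thesis by blast
  qed
  have q: "u \<in> quarter_turns u" "\<i> * u \<in> quarter_turns u" "- u \<in> quarter_turns u" "- \<i> * u \<in> quarter_turns u"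
    unfolding quarter_turns_dir by (auto simp: dir_values)
  consider "0 \<le> a + b - 1" "0 \<le> b - a" | "a + b - 1 \<le> 0" "0 \<le> b - a"
    | "a + b - 1 \<le> 0" "b - a \<le> 0" | "0 \<le> a + b - 1" "b - a \<le> 0" by linarith
  then have "\<exists>t\<in>T. apex t = mid m n \<and> x \<in> convex hull triangle_vertices t"
  proof cases
    case 1
    have "x = mid m n + of_real (a + b - 1) * u + of_real (b - a) * (\<i> * u)"
      unfolding x by (simp add: algebra_simps)
    from main[OF q(1) _ _ _ this] show ?thesis using 1 ab by simp
  next
    case 2
    have "x = mid m n + of_real (b - a) * (\<i> * u) + of_real (1 - a - b) * (\<i> * (\<i> * u))"
      unfolding x by (simp add: algebra_simps)
    from main[OF q(2) _ _ _ this] show ?thesis using 2 ab by simp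
  next
    case 3
    have "x = mid m n + of_real (1 - a - b) * (- u) + of_real (a - b) * (\<i> * (- u))"
      unfolding x by (simp add: algebra_simps)
    from main[OF q(3) _ _ _ this] show ?thesis using 3 ab by simp
  next
    case 4
    have "x = mid m n + of_real (a - b) * (- \<i> * u) + of_real (a + b - 1) * (\<i> * (- \<i> * u))"
      unfolding x by (simp add: algebra_simps)
    from main[OF q(4) _ _ _ this] show ?thesis using 4 ab by simp
  qed
  then show ?thesis by blast
qed

text \<open>The tiles of the lattice built from \<open>x0\<close> already cover the plane, so a base
  vertex lies in one of them, and \<open>base_in_tile\<close> puts it at a corner.\<close>

lemma base_vertex_in_grid:
  assumes "x \<in> base_vertices T"
  shows "\<exists>p q. x = pos p q"
proof -
  obtain t m n where t: "t \<in> T" "apex t = mid m n" "x \<in> convex hull triangle_vertices t"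
    using tile_containing by blast
  then have "x - mid m n \<in> quarter_turns u" using base_in_tile[OF assms] by metis
  then obtain k where "k \<in> {1,3,5,7}" "x - mid m n = dir u k" unfolding quarter_turns_dir by blast
  then have "x \<in> {mid m n + dir u 5, mid m n + dir u 7, mid m n + dir u 1, mid m n + dir u 3}"
    by (auto simp: algebra_simps)
  then show ?thesis unfolding corners[of m n, symmetric] by blast
qed

lemma aperiodic:
  assumes shift: "shift_triangle w ` T = T"
  shows "w = 0"
proof -
  have "x0 + w \<in> base_vertices T"
  proof -
    obtain t where t: "t \<in> T" "x0 \<in> {apex t + leg t, apex t + \<i> * leg t}"
      using x0 unfolding base_vertices_def by blast
    then have "shift_triangle w t \<in> T" using shift by blast
    from base_verticesI[OF this] t(2) show ?thesis
      by (auto simp: shift_triangle_def algebra_simps)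
  qed
  then obtain p q where pq: "x0 + w = pos p q" using base_vertex_in_grid by blast
  then have w: "w = of_int p * dir u 0 + of_int q * dir u 2" by (simp add: pos_def algebra_simps)
  have arrow: "Arrow (y + w) (z + w) c \<in> arrows \<longleftrightarrow> Arrow y z c \<in> arrows" for y z c
  proof
    assume "Arrow y z c \<in> arrows"
    then obtain t where t: "t \<in> T" "Arrow y z c \<in> sides t" by blast
    then have "shift_arrow w (Arrow y z c) \<in> sides (shift_triangle w t)"
      by (simp add: shift_triangle_def)
    then have "Arrow (y + w) (z + w) c \<in> sides (shift_triangle w t)" by (simp add: shift_arrow_def)
    moreover have "shift_triangle w t \<in> T" using t(1) shift by blast
    ultimately show "Arrow (y + w) (z + w) c \<in> arrows" by blast
  next
    assume "Arrow (y + w) (z + w) c \<in> arrows"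
    then obtain t' where t': "t' \<in> T" "Arrow (y + w) (z + w) c \<in> sides t'" by blast
    then have "t' \<in> shift_triangle w ` T" using shift by simp
    then obtain t where t: "t \<in> T" "Arrow (y + w) (z + w) c \<in> sides (shift_triangle w t)"
      using t'(2) by blast
    then obtain a where a: "a \<in> sides t" "Arrow (y + w) (z + w) c = shift_arrow w a"
      by (auto simp: shift_triangle_def)
    then have "a = Arrow y z c" by (cases a) (simp add: shift_arrow_def)
    then show "Arrow y z c \<in> arrows" using a t by blast
  qed
  have "pos (x + p) (y + q) = pos x y + w" for x y by (simp add: pos_def w algebra_simps)
  moreover have "pos x y + w + dir u k = pos x y + dir u k + w" for x y k by simp
  ultimately have per: "out_at (pos (x + p) (y + q)) k = out_at (pos x y) k" for x y k
    unfolding out_at_def by (simp only: arrow)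
  obtain c where "checkered_grid (\<lambda>x y. out_at (pos x y)) (\<lambda>x y. green_at (pos x y)) c"
    using checkered_grid_at by blast
  then interpret checkered_grid "\<lambda>x y. out_at (pos x y)" "\<lambda>x y. green_at (pos x y)" c .
  \<comment> \<open>Here \<open>aperiodic\<close> is the fact about \<open>checkered_grid\<close>
    that the interpretation provides.\<close>
  have "p = 0 \<and> q = 0" using aperiodic[of p q] per by blast
  then show ?thesis using w by simp
qed

end

lemma (in crossing_tiling) not_periodic: "\<not> periodic shift_triangle T"
proof -
  obtain x0 where "x0 \<in> base_vertices T" using base_origin by blast
  then interpret based_tiling u T x0 by unfold_locales
  show ?thesis using aperiodic unfolding periodic_def by blast
qed

text \<open>All other points of the sphere lie strictly on the inner side of the tangent hyperplane
  at \<open>x\<close>, in an open half-space missing \<open>x\<close>.\<close>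

lemma sphere_convex_hull:
  fixes c :: "'a :: euclidean_space"
  assumes "S \<subseteq> sphere c r" "x \<in> sphere c r" "x \<in> convex hull S"
  shows "x \<in> S"
proof (rule ccontr)
  assume n: "x \<notin> S"
  have sph: "(y - c) \<bullet> (y - c) = r\<^sup>2" if "y \<in> sphere c r" for y
    using that by (simp add: dist_norm norm_minus_commute dot_square_norm)
  have "S \<subseteq> {z. (x - c) \<bullet> z < r\<^sup>2 + (x - c) \<bullet> c}"
  proof
    fix z assume z: "z \<in> S"
    then have "(z - x) \<bullet> (z - x) > 0" using n by auto
    moreover have "z - x = (z - c) - (x - c)" by simp
    ultimately have "2 * ((x - c) \<bullet> (z - c)) < (z - c) \<bullet> (z - c) + (x - c) \<bullet> (x - c)"
      by (simp only: inner_diff_left inner_diff_right inner_commute) (simp add: inner_commute algebra_simps)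
    then have "(x - c) \<bullet> (z - c) < r\<^sup>2" using sph z assms(1,2) by auto
    then show "z \<in> {z. (x - c) \<bullet> z < r\<^sup>2 + (x - c) \<bullet> c}" by (simp add: inner_diff_right)
  qed
  then have "convex hull S \<subseteq> {z. (x - c) \<bullet> z < r\<^sup>2 + (x - c) \<bullet> c}"
    by (intro hull_minimal convex_halfspace_lt)
  then have "(x - c) \<bullet> x < r\<^sup>2 + (x - c) \<bullet> c" using assms(3) by blast
  then show False using sph[OF assms(2)] by (simp add: inner_diff_right)
qed

context matched_tiles
begin

lemma leg_quarter_turn: "t \<in> T \<Longrightarrow> leg t \<in> quarter_turns u" "t \<in> T \<Longrightarrow> \<i> * leg t \<in> quarter_turns u"
  using leg_dir[of t] unfolding quarter_turns_dir by (auto simp: dir_values mult.commute[of u \<i>])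

lemma leg_diagonals:
  assumes "t \<in> T"
  shows "\<exists>k. even k \<and> \<i> * leg t = leg t + dir u k" "\<exists>k. even k \<and> (1 + \<i>) * leg t = dir u k"
proof -
  obtain k where k: "k \<in> {1,3,5,7}" "leg t = dir u k" using leg_dir assms by blast
  have "\<i> * dir u k - dir u k = dir u (k + 3)" "(1 + \<i>) * dir u k = dir u (k + 1)"
    using k(1) dir_period[of u 0] dir_period[of u 2]
    by (elim insertE emptyE; simp add: dir_values algebra_simps)+
  moreover have "even (k + 3)" "even (k + 1)" using k(1) by auto
  ultimately show "\<exists>k. even k \<and> \<i> * leg t = leg t + dir u k" "\<exists>k. even k \<and> (1 + \<i>) * leg t = dir u k"
    unfolding k(2) by (metis add.commute diff_add_cancel)+
qed

text \<open>A hypotenuse ends at \<open>x\<close> in an even direction, but a \<open>C4\<close>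
  crossing has arrows in odd directions only.\<close>

lemma base_vertex_not_C4:
  assumes "x \<in> base_vertices T" "d \<in> quarter_turns u"
  shows "\<not> C4 x d (crossing T x)"
proof
  assume C: "C4 x d (crossing T x)"
  obtain t where t: "t \<in> T" "x \<in> {apex t + leg t, apex t + \<i> * leg t}"
    using assms(1) unfolding base_vertices_def by blast
  obtain a where a: "a \<in> sides t" "ends a = {apex t + leg t, apex t + \<i> * leg t}" using base_side t(1) by blast
  obtain k where k: "even k" "\<i> * leg t = leg t + dir u k" using leg_diagonals t(1) by blast
  from t(2) consider "x = apex t + leg t" | "x = apex t + \<i> * leg t" by blast
  then have "\<exists>k. even k \<and> ends a = {x, x + dir u k}"
  proof cases
    case 1
    then have "ends a = {x, x + dir u k}" using a(2) k(2) by (simp add: add.assoc)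
    then show ?thesis using k(1) by blast
  next
    case 2
    then have "ends a = {x, x + dir u (k + 4)}" using a(2) k(2) by (simp add: dir_add_4 insert_commute)
    then show ?thesis using k(1) by (metis even_add even_numeral)
  qed
  then show False using C4_no_diagonal[OF assms(2) C] a(1) t(1) by blast
qed

end

section \<open>Tilings by triangles and by squares\<close>

text \<open>Thales: the circumscribed circle is centered at the midpoint of the hypotenuse.\<close>

lemma triangle_vertices_sphere:
  "triangle_vertices t \<subseteq> sphere (apex t + (1 + \<i>) * leg t / 2) (cmod (leg t) / sqrt 2)"
proof -
  have n: "cmod (1 + \<i>) = sqrt 2" "cmod (1 - \<i>) = sqrt 2" "cmod (\<i> - 1) = sqrt 2" by (simp_all add: cmod_def)
  have m: "cmod (z * leg t / 2) = cmod (leg t) / sqrt 2" if "cmod z = sqrt 2" for z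
    using that by (simp add: norm_mult norm_divide field_simps)
  have e: "apex t + (1 + \<i>) * leg t / 2 - apex t = (1 + \<i>) * leg t / 2"
    "apex t + (1 + \<i>) * leg t / 2 - (apex t + leg t) = (\<i> - 1) * leg t / 2"
    "apex t + (1 + \<i>) * leg t / 2 - (apex t + \<i> * leg t) = (1 - \<i>) * leg t / 2"
    by (simp_all add: field_simps)
  show ?thesis unfolding triangle_vertices_def
    by (simp only: insert_subset empty_subsetI mem_sphere dist_norm e m[OF n(1)] m[OF n(2)] m[OF n(3)])
qed

lemma midpoint_not_in_leg:
  assumes "l \<noteq> 0" "y = x + l \<or> y = x + \<i> * l"
  shows "x + (1 + \<i>) * l / 2 \<notin> convex hull {x, y}"
proof
  assume "x + (1 + \<i>) * l / 2 \<in> convex hull {x, y}"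
  then obtain r where r: "x + (1 + \<i>) * l / 2 = x + r *\<^sub>R (y - x)"
    unfolding convex_hull_2_alt by auto
  from assms(2) have "(1 + \<i>) / 2 = of_real r \<or> (1 + \<i>) / 2 = of_real r * \<i>"
  proof
    assume "y = x + l"
    then have "((1 + \<i>) / 2 - of_real r) * l = 0" using r by (simp add: scaleR_conv_of_real field_simps)
    then show ?thesis using assms(1) by simp
  next
    assume "y = x + \<i> * l"
    then have "((1 + \<i>) / 2 - of_real r * \<i>) * l = 0" using r by (simp add: scaleR_conv_of_real field_simps)
    then show ?thesis using assms(1) by simp
  qed
  then show False by (auto simp: complex_eq_iff)
qed

text \<open>A \<open>C8\<close> crossing at the apex would have an arrow bisecting the right angle.
  Being the hypotenuse of some tile \<open>s\<close>, it meets the hypotenuse of \<open>t\<close> in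
  its midpoint, which is then common to both tiles; but their common vertices span at most a leg of
  \<open>t\<close>.\<close>

lemma (in matched_tiles) apex_not_C8:
  assumes tiling: "side_to_side_tiling triangle_vertices T"
    and t: "t \<in> T" and d: "d \<in> eighth_turns u" and C: "C8 (apex t) d (crossing T (apex t))"
  shows False
proof -
  define x l where "x = apex t" and "l = leg t"
  have l0: "l \<noteq> 0" using leg_dir[OF t] dir_nonzero[OF nonzero] unfolding l_def by auto
  obtain k where k: "even k" "(1 + \<i>) * l = dir u k" using leg_diagonals(2)[OF t] unfolding l_def by blast
  obtain a where "a \<in> arrows" and a: "ends a = {x, x + (1 + \<i>) * l}"
    using C8_star(2)[OF d C, of k] unfolding k(2) x_def by blast
  then obtain s where s: "s \<in> T" "a \<in> sides s" by blast
  have "\<not> (odd m \<and> ends a = {y, y + dir u m})" for m y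
    using doubleton_dir[of x k y m] a k parity_mod_8[of k m] parity_mod_8[of "k + 4" m] by auto
  then have "{x, x + (1 + \<i>) * l} = {apex s + leg s, apex s + \<i> * leg s}"
    using sides_cases[OF s] a by metis
  then consider "x = apex s + leg s" "x + (1 + \<i>) * l = apex s + \<i> * leg s"
    | "x = apex s + \<i> * leg s" "x + (1 + \<i>) * l = apex s + leg s"
    by (auto simp: doubleton_eq_iff)
  then have s_pos: "apex s = x + l \<or> apex s = x + \<i> * l"
  proof cases
    case 1
    then have "(1 + \<i>) * l = (\<i> - 1) * leg s" by (simp add: algebra_simps)
    then have "\<i> * ((1 + \<i>) * l) = \<i> * ((\<i> - 1) * leg s)" by simp
    then have "(\<i> - 1) * l = (\<i> - 1) * (\<i> * leg s)" by (simp add: algebra_simps)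
    moreover have "\<i> - 1 \<noteq> 0" by (simp add: complex_eq_iff)
    ultimately have "l = \<i> * leg s" by (metis mult_cancel_left)
    then show ?thesis using 1(1) by simp
  next
    case 2
    then have "(1 + \<i>) * l = (1 - \<i>) * leg s" by (simp add: algebra_simps)
    then have "(1 + \<i>) * l = (1 + \<i>) * (- \<i> * leg s)" by (simp add: algebra_simps)
    moreover have "1 + \<i> \<noteq> 0" by (simp add: complex_eq_iff)
    ultimately have "l = - \<i> * leg s" by (metis mult_cancel_left)
    then show ?thesis using 2(1) by simp
  qed
  let ?m = "x + (1 + \<i>) * l / 2"
  have mid: "(y + z) / 2 \<in> convex hull V" if "y \<in> V" "z \<in> V" for y z :: complex and V
  proof -
    have "midpoint y z \<in> closed_segment y z" by simp
    also have "closed_segment y z \<subseteq> convex hull V"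
      using that by (intro closed_segment_subset_convex_hull hull_inc)
    finally show ?thesis by (simp add: midpoint_def scaleR_conv_of_real)
  qed
  have "?m = ((x + l) + (x + \<i> * l)) / 2" by (simp add: field_simps)
  moreover have "x + l \<in> triangle_vertices t" "x + \<i> * l \<in> triangle_vertices t"
    unfolding triangle_vertices_def x_def l_def by blast+
  ultimately have mt: "?m \<in> convex hull triangle_vertices t" using mid by (simp only:)
  have xs: "x \<in> triangle_vertices s" "x + (1 + \<i>) * l \<in> triangle_vertices s"
    using \<open>{x, x + (1 + \<i>) * l} = _\<close> unfolding triangle_vertices_def by blast+
  have "?m = (x + (x + (1 + \<i>) * l)) / 2" by (simp add: field_simps)
  then have ms: "?m \<in> convex hull triangle_vertices s" using mid[OF xs] by (simp only:)
  have "apex s \<noteq> apex t" using s_pos l0 unfolding x_def by auto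
  then have "convex hull triangle_vertices s \<inter> convex hull triangle_vertices t =
      convex hull (triangle_vertices s \<inter> triangle_vertices t)"
    using tiling s(1) t unfolding side_to_side_tiling_def by metis
  then have "?m \<in> convex hull (triangle_vertices s \<inter> triangle_vertices t)" using ms mt by blast
  moreover have "triangle_vertices s \<inter> triangle_vertices t \<subseteq> {x, apex s}"
  proof -
    have "triangle_vertices s = {apex s, x, x + (1 + \<i>) * l}"
      using \<open>{x, x + (1 + \<i>) * l} = _\<close> unfolding triangle_vertices_def by simp
    moreover have "x + (1 + \<i>) * l \<notin> triangle_vertices t"
      unfolding triangle_vertices_def x_def[symmetric] l_def[symmetric] using l0
      by (auto simp: algebra_simps add_eq_0_iff complex_eq_iff)
    ultimately show ?thesis by blast
  qed
  ultimately have "?m \<in> convex hull {x, apex s}" using hull_mono by blast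
  then show False using midpoint_not_in_leg[OF l0 s_pos] by blast
qed

lemma crossing_tiling_triangles:
  assumes "u \<noteq> 0" "correct_triangle_tiling u T"
  shows "crossing_tiling u T"
proof -
  have tiles: "\<And>t. t \<in> T \<Longrightarrow> triangular_tile u t"
    and tiling: "side_to_side_tiling triangle_vertices T"
    and match: "shared_sides_match T" and differ: "neighbours_differ T"
    and vertex: "\<And>x. x \<in> \<Union> (triangle_vertices ` T) \<Longrightarrow>
        (\<exists>d\<in>quarter_turns u. C4 x d (crossing T x)) \<or> (\<exists>d\<in>eighth_turns u. C8 x d (crossing T x))"
    and rlgr: "\<And>x d. d \<in> quarter_turns u \<Longrightarrow> C4 x d (crossing T x) \<Longrightarrow> red_left_green_right T x d"
    using assms(2) unfolding correct_triangle_tiling_def by blast+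
  interpret matched_tiles u T by unfold_locales (use assms(1) tiles match in auto)
  have base_vertex: "x \<in> \<Union> (triangle_vertices ` T)" if "x \<in> base_vertices T" for x
    using that unfolding base_vertices_def triangle_vertices_def by blast
  have C8: "\<exists>d\<in>eighth_turns u. C8 x d (crossing T x)" if "x \<in> base_vertices T" for x
    using vertex[OF base_vertex[OF that]] base_vertex_not_C4[OF that] by blast
  have C4: "\<exists>d\<in>quarter_turns u. C4 (apex t) d (crossing T (apex t)) \<and> red_left_green_right T (apex t) d"
    if "t \<in> T" for t
  proof -
    have "apex t \<in> \<Union> (triangle_vertices ` T)" using that unfolding triangle_vertices_def by blast
    then show ?thesis using vertex rlgr apex_not_C8[OF tiling that] by blast
  qed
  show ?thesis
  proof
    show "T \<noteq> {}" using tiling unfolding side_to_side_tiling_def by auto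
    show "neighbours_differ T" by (rule differ)
    show "\<exists>d\<in>quarter_turns u. C4 (apex t) d (crossing T (apex t)) \<and> red_left_green_right T (apex t) d"
      if "t \<in> T" for t by (rule C4[OF that])
    show "\<exists>d\<in>eighth_turns u. C8 x d (crossing T x)" if "x \<in> base_vertices T" for x by (rule C8[OF that])
    show "x - apex t \<in> quarter_turns u"
      if x: "x \<in> base_vertices T" and t: "t \<in> T" and xt: "x \<in> convex hull triangle_vertices t" for x t
    proof -
      obtain s where s: "s \<in> T" "x \<in> triangle_vertices s" using base_vertex[OF x] by blast
      \<comment> \<open>Side-to-side contact puts \<open>x\<close> into the hull of the common
        vertices. Being a vertex of \<open>s\<close>, it lies on the circumscribed circle of
        \<open>s\<close> and thus is one of them.\<close>
      have "x \<in> triangle_vertices t"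
      proof (cases "s = t")
        case False
        then have "convex hull triangle_vertices s \<inter> convex hull triangle_vertices t =
            convex hull (triangle_vertices s \<inter> triangle_vertices t)"
          using tiling s(1) t unfolding side_to_side_tiling_def by metis
        then have "x \<in> convex hull (triangle_vertices s \<inter> triangle_vertices t)"
          using xt hull_inc[OF s(2), of convex] by blast
        then show ?thesis
          using sphere_convex_hull[of "triangle_vertices s \<inter> triangle_vertices t"] triangle_vertices_sphere[of s] s(2)
          by blast
      qed (use s in simp)
      moreover have "x \<noteq> apex t" using C4[OF t] C8[OF x] not_C4_and_C8 by blast
      ultimately show ?thesis using leg_quarter_turn[OF t] unfolding triangle_vertices_def by auto
    qed
  qed
qed

section \<open>Square tiles\<close>

lemma quarter_turns_sphere: "l \<in> quarter_turns u \<Longrightarrow> cmod l = cmod u"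
  unfolding quarter_turns_def by (auto simp: norm_mult norm_power)

lemma square_vertices_iff: "x \<in> square_vertices u s \<longleftrightarrow> x - center s \<in> quarter_turns u"
  unfolding square_vertices_def by (auto simp: image_iff algebra_simps) (metis add.commute diff_add_cancel)

lemma square_vertices_sphere: "square_vertices u s \<subseteq> sphere (center s) (cmod u)"
  using quarter_turns_sphere[of _ u] by (auto simp: square_vertices_iff dist_norm norm_minus_commute)

text \<open>Such a sum has length 0, sqrt 2 or 2 times that of \<open>u\<close>.\<close>

lemma quarter_turns_sum:
  assumes "u \<noteq> 0" "k \<in> quarter_turns u" "l \<in> quarter_turns u"
  shows "k + l \<notin> quarter_turns u"
proof
  assume "k + l \<in> quarter_turns u"
  have q: "quarter_turns u = (\<lambda>z. z * u) ` {1, \<i>, - 1, - \<i>}"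
    unfolding quarter_turns_dir by (auto simp: dir_values mult.commute)
  obtain a b c where abc: "a \<in> {1, \<i>, - 1, - \<i>}" "b \<in> {1, \<i>, - 1, - \<i>}" "c \<in> {1, \<i>, - 1, - \<i>}"
    and kl: "k = a * u" "l = b * u" "k + l = c * u"
    using assms \<open>k + l \<in> _\<close> unfolding q by blast
  then have "(a + b) * u = c * u" by (simp add: algebra_simps)
  then have "a + b = c" using assms(1) by simp
  then show False using abc by (auto simp: complex_eq_iff)
qed

lemma center_in_hull: "center s \<in> convex hull square_vertices u s"
proof -
  have "u \<in> quarter_turns u" "- u \<in> quarter_turns u" unfolding quarter_turns_dir by (auto simp: dir_values)
  then have "center s + u \<in> square_vertices u s" "center s - u \<in> square_vertices u s"
    by (simp_all add: square_vertices_iff)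
  then have "closed_segment (center s + u) (center s - u) \<subseteq> convex hull square_vertices u s"
    by (intro closed_segment_subset_convex_hull hull_inc)
  moreover have "midpoint (center s + u) (center s - u) = center s"
    by (simp add: midpoint_def scaleR_conv_of_real)
  ultimately show ?thesis by (metis midpoint_in_closed_segment subsetD)
qed

lemma crossing_tiling_squares:
  assumes "u \<noteq> 0" "correct_square_tiling u S"
  shows "crossing_tiling u (\<Union> (quarters ` S))"
proof -
  let ?T = "\<Union> (quarters ` S)"
  have squares: "\<And>s. s \<in> S \<Longrightarrow> square_tile u s"
    and tiling: "side_to_side_tiling (square_vertices u) S"
    and match: "shared_sides_match ?T" and differ: "neighbours_differ ?T"
    and vertex: "\<And>x. x \<in> \<Union> (square_vertices u ` S) \<Longrightarrow> \<exists>d\<in>eighth_turns u. C8 x d (crossing ?T x)"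
    using assms(2) unfolding correct_square_tiling_def by blast+
  have tiles: "triangular_tile u t" "apex t = center s" if "s \<in> S" "t \<in> quarters s" for s t
    using squares[OF that(1)] that(2) unfolding square_tile_def by blast+
  interpret matched_tiles u ?T by unfold_locales (use assms(1) tiles match in auto)
  have meet: "convex hull square_vertices u s \<inter> convex hull square_vertices u s' =
      convex hull (square_vertices u s \<inter> square_vertices u s')" if "s \<in> S" "s' \<in> S" "s \<noteq> s'" for s s'
    using tiling that unfolding side_to_side_tiling_def by metis
  \<comment> \<open>Otherwise both hulls contain \<open>center s\<close>, so the squares share a
    vertex y. Then y - center s' is a quarter turn and also the sum of two, y - center s and center
    s - center s'.\<close>
  have center_not_vertex: "center s - center s' \<notin> quarter_turns u" if s: "s \<in> S" "s' \<in> S" for s s'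
  proof
    assume q: "center s - center s' \<in> quarter_turns u"
    then have "s \<noteq> s'" using quarter_turns_sphere[OF q] assms(1) by auto
    then have "center s \<in> convex hull (square_vertices u s \<inter> square_vertices u s')"
      using meet[OF s] center_in_hull[of s u] hull_inc[of "center s" "square_vertices u s'" convex] q
      by (auto simp: square_vertices_iff)
    then obtain y where "y - center s \<in> quarter_turns u" "y - center s' \<in> quarter_turns u"
      by (metis IntE convex_hull_empty empty_iff square_vertices_iff ex_in_conv)
    then show False using quarter_turns_sum[OF assms(1) _ q, of "y - center s"] by simp
  qed
  have base_vertex: "\<exists>s\<in>S. x \<in> square_vertices u s" if "x \<in> base_vertices ?T" for x
  proof -
    obtain s t where st: "s \<in> S" "t \<in> quarters s" "x = apex t + leg t \<or> x = apex t + \<i> * leg t"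
      using \<open>x \<in> base_vertices ?T\<close> unfolding base_vertices_def by blast
    then have "t \<in> ?T" by blast
    then have "x \<in> square_vertices u s"
      using leg_quarter_turn[of t] tiles(2)[OF st(1,2)] st(3) by (auto simp: square_vertices_iff)
    then show ?thesis using st(1) by blast
  qed
  \<comment> \<open>Any arrow at \<open>center s\<close> is a half-diagonal of a square with the
    same center, and matching sides identify it with a side of a quarter of
    \<open>s\<close>.\<close>
  have crossing_center: "crossing ?T (center s) = crossing (quarters s) (center s)" if s: "s \<in> S" for s
  proof
    show "crossing (quarters s) (center s) \<subseteq> crossing ?T (center s)" using s unfolding crossing_def by blast
    show "crossing ?T (center s) \<subseteq> crossing (quarters s) (center s)"
    proof
      fix a assume "a \<in> crossing ?T (center s)"
      then obtain s' t' where s': "s' \<in> S" "t' \<in> quarters s'" "a \<in> sides t'" and c: "center s \<in> ends a"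
        unfolding crossing_def by blast
      have t': "t' \<in> ?T" using s' by blast
      have apex: "apex t' = center s'" using tiles(2) s' by blast
      have no: "center s \<noteq> apex t' + leg t'" "center s \<noteq> apex t' + \<i> * leg t'"
        using center_not_vertex[OF s s'(1)] leg_quarter_turn[OF t'] apex by auto
      have "(\<exists>l\<in>quarter_turns u. ends a = {apex t', apex t' + l}) \<or> ends a = {apex t' + leg t', apex t' + \<i> * leg t'}"
        using sides_cases[OF t' s'(3)] leg_quarter_turn[OF t'] by metis
      then obtain l where l: "l \<in> quarter_turns u" "ends a = {center s', center s' + l}"
        using c no apex by auto
      have same: "center s = center s'" using c l center_not_vertex[OF s s'(1)] by auto
      obtain t where t: "t \<in> quarters s" "leg t = l" using squares[OF s] l(1) unfolding square_tile_def by blast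
      obtain b where b: "b \<in> sides t" "ends b = {apex t, apex t + leg t}"
        using tiles(1)[OF s t(1)] unfolding triangular_tile_def by auto
      have "a = b" using arrow_unique[of a b] b l t tiles(2)[OF s t(1)] same s s' by auto
      then show "a \<in> crossing (quarters s) (center s)" using b t c unfolding crossing_def by blast
    qed
  qed
  show ?thesis
  proof
    have "S \<noteq> {}" using tiling unfolding side_to_side_tiling_def by auto
    then obtain s where s: "s \<in> S" by blast
    have "\<forall>d\<in>quarter_turns u. \<exists>!t. t \<in> quarters s \<and> leg t = d"
      using squares[OF s] unfolding square_tile_def by (elim conjE)
    moreover have "u \<in> quarter_turns u" unfolding quarter_turns_dir by (auto simp: dir_values)
    ultimately have "\<exists>t. t \<in> quarters s" by metis
    then show "?T \<noteq> {}" using s by blast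
    show "neighbours_differ ?T" by (rule differ)
    show "\<exists>d\<in>quarter_turns u. C4 (apex t) d (crossing ?T (apex t)) \<and> red_left_green_right ?T (apex t) d"
      if "t \<in> ?T" for t
    proof -
      obtain s where s: "s \<in> S" "t \<in> quarters s" using \<open>t \<in> ?T\<close> by blast
      obtain d where d: "d \<in> quarter_turns u" "C4 (center s) d (crossing (quarters s) (center s))"
        "red_left_green_right (quarters s) (center s) d" using squares[OF s(1)] unfolding square_tile_def by blast
      have "red_left_green_right ?T (center s) d"
        using d(3) s(1) unfolding red_left_green_right_def crossing_center[OF s(1)] by blast
      then show ?thesis using d crossing_center[OF s(1)] tiles(2)[OF s] by auto
    qed
    show "\<exists>d\<in>eighth_turns u. C8 x d (crossing ?T x)" if "x \<in> base_vertices ?T" for x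
      using vertex base_vertex[OF that] by blast
    show "x - apex t \<in> quarter_turns u"
      if x: "x \<in> base_vertices ?T" and t: "t \<in> ?T" and xt: "x \<in> convex hull triangle_vertices t" for x t
    proof -
      obtain s where s: "s \<in> S" "t \<in> quarters s" using t by blast
      obtain s' where s': "s' \<in> S" "x \<in> square_vertices u s'" using base_vertex[OF x] by blast
      have apex: "apex t = center s" using tiles(2)[OF s] .
      have "triangle_vertices t \<subseteq> convex hull square_vertices u s"
        using center_in_hull[of s u] leg_quarter_turn[OF t] apex
          hull_inc[of "apex t + leg t" "square_vertices u s" convex] hull_inc[of "apex t + \<i> * leg t" "square_vertices u s" convex]
        unfolding triangle_vertices_def by (simp add: square_vertices_iff)
      then have xs: "x \<in> convex hull square_vertices u s"
        using xt hull_minimal[of "triangle_vertices t" "convex hull square_vertices u s" convex] by blast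
      have "x \<in> square_vertices u s"
      proof (cases "s' = s")
        case False
        then have "x \<in> convex hull (square_vertices u s' \<inter> square_vertices u s)"
          using meet[OF s'(1) s(1)] xs hull_inc[OF s'(2), of convex] by blast
        then show ?thesis
          using sphere_convex_hull[of "square_vertices u s' \<inter> square_vertices u s"] square_vertices_sphere[of u s'] s'(2)
          by blast
      qed (use s' in simp)
      then show ?thesis using apex by (simp add: square_vertices_iff)
    qed
  qed
qed

lemma periodic_squares: "periodic shift_square S \<Longrightarrow> periodic shift_triangle (\<Union> (quarters ` S))"
proof -
  assume "periodic shift_square S"
  then obtain w where w: "w \<noteq> 0" "shift_square w ` S = S" unfolding periodic_def by blast
  have "shift_triangle w ` \<Union> (quarters ` S) = \<Union> (quarters ` shift_square w ` S)"
    by (simp add: image_UN image_image shift_square_def)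
  then show ?thesis using w unfolding periodic_def by auto
qed

theorem theorem3:
  shows "(\<forall>(u::complex) T. u \<noteq> 0 \<and> correct_triangle_tiling u T \<longrightarrow> \<not> periodic shift_triangle T) \<and>
         (\<forall>(u::complex) S. cmod u = 1 / sqrt 2 \<and> correct_square_tiling u S \<longrightarrow> \<not> periodic shift_square S)"
proof (intro conjI allI impI; elim conjE)
  fix u :: complex and T assume "u \<noteq> 0" "correct_triangle_tiling u T"
  then show "\<not> periodic shift_triangle T"
    using crossing_tiling_triangles crossing_tiling.not_periodic by blast
next
  fix u :: complex and S assume "cmod u = 1 / sqrt 2" "correct_square_tiling u S"
  moreover from this have "u \<noteq> 0" by auto
  ultimately show "\<not> periodic shift_square S"
    using crossing_tiling_squares crossing_tiling.not_periodic periodic_squares by blast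
qed

end
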